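(* Let $k\ge2$ and let $(M_1,\ldots,M_k)$ be an amicable $k$-tuple such that $M_1,\ldots,M_k$ are pairwise coprime and $\gcd(M_1\cdots M_k,\,M_1+\cdots+M_k)=1$. Then \[ M_1\cdots M_k<\frac{\pi^2}{6}\,2^{4^K-2\cdot 2^K}, \] where $K=\omega(M_1\cdots M_k)$.
   Context: $\sigma(n)$ denotes the sum of the positive divisors of $n$ and $\omega(n)$ the number of distinct prime factors of $n$. For an integer $k\ge2$, a tuple of positive integers $(M_1,\ldots,M_k)$ is an amicable $k$-tuple if $\sigma(M_1)=\cdots=\sigma(M_k)=M_1+\cdots+M_k$. *)

theory Defs
  imports Complex_Main "HOL-Computational_Algebra.Primes"
begin

definition divisor_sigma :: "nat \<Rightarrow> nat" where
  "divisor_sigma n = (\<Sum>d | d dvd n. d)"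

definition prime_omega :: "nat \<Rightarrow> nat" where
  "prime_omega n = card (prime_factors n)"

(* A k-tuple is a function of which only the values at 1, ..., k matter;
   repeated entries are allowed. *)
definition amicable_tuple :: "nat \<Rightarrow> (nat \<Rightarrow> nat) \<Rightarrow> bool" where
  "amicable_tuple k M \<longleftrightarrow> k \<ge> 2 \<and>
     (\<forall>i\<in>{1..k}. M i > 0 \<and> divisor_sigma (M i) = (\<Sum>j=1..k. M j))"

end

theory Submission
  imports Defs
begin

text \<open>Write p^e for the prime powers exactly dividing N = M_1 ... M_k. Since
  M_i / sigma(M_i) is the product of the factors (1 - 1/p) / (1 - 1/p^(e+1)) over p dividing M_i,
  the sum V of these products equals 1. Start with all factors replaced by 1, so V = k > 1, and
  let primes become known (factor 1 - 1/p) in increasing order until V \<le> 1, then let known primes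
  become resolved (full factor) in increasing order of p^(e+1) until V \<ge> 1, and repeat.
  At every moment V has an explicit common denominator D, so V differs from 1 by at least 1/D
  (V is not 1 before the end, by the coprimality assumption). A product of factors 1 - 1/x that
  carries V across 1 then bounds the product of the x, in the style of Curtiss and Sylvester: each
  of the 2K steps at most squares the bound on D + 1. The saving 2 * 2^K comes from
  the first cycle, where resolving replaces the known prime p in D by sigma(p^e), which is
  about p^(e+1) / (p (p - 1)) times as large.\<close>

subsection \<open>Greedy products of factors 1 - 1/x\<close>

text \<open>The map u \<mapsto> ln (1 - exp (- u)) is concave and lies below its tangent at u = ln x.\<close>

lemma ln_one_minus_inverse_tangent:
  fixes x y :: real
  assumes "x > 1" "y > 1"
  shows "(ln x - ln y) / (x - 1) \<le> ln (1 - 1 / x) - ln (1 - 1 / y)"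
proof -
  let ?u = "(y - 1) / (x - 1)" and ?v = "y / x"
  have pos: "?u > 0" "?v > 0" using assms by auto
  have "ln ?u - ln ?v \<le> ?u / ?v - 1"
    using pos ln_le_minus_one[of "?u / ?v"] ln_div[of ?u ?v] assms by simp
  then have "(x - 1) * (ln ?u - ln ?v) \<le> (x - 1) * (?u / ?v - 1)"
    using assms by (intro mult_left_mono) auto
  moreover have "- ln ?v \<le> 1 / ?v - 1"
    using pos ln_le_minus_one[of "1 / ?v"] ln_div[of 1 ?v] assms by simp
  moreover have "(x - 1) * (?u / ?v - 1) + (1 / ?v - 1) = 0"
    using assms by (simp add: field_simps)
  ultimately have *: "(x - 1) * (ln ?u - ln ?v) - ln ?v \<le> 0" by linarith
  have "ln (1 - 1 / x) = ln (x - 1) - ln x" "ln (1 - 1 / y) = ln (y - 1) - ln y"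
    using assms ln_div[of "x - 1" x] ln_div[of "y - 1" y] by (auto simp: diff_divide_distrib)
  moreover have "ln ?u = ln (y - 1) - ln (x - 1)" "ln ?v = ln y - ln x"
    using assms by (auto simp: ln_div)
  ultimately have "ln x - ln y \<le> (x - 1) * (ln (1 - 1 / x) - ln (1 - 1 / y))"
    using * by (simp only:) (simp add: algebra_simps)
  then show ?thesis
    using assms by (simp add: pos_divide_le_eq mult.commute)
qed

text \<open>Abel summation by induction: the weight on the partial sum up to \<open>n\<close> may be
  lowered from \<open>w n\<close> to \<open>w (Suc n)\<close> because that partial sum is
  nonnegative.\<close>

lemma weighted_sum_ge:
  fixes w d :: "nat \<Rightarrow> real"
  assumes "t \<le> n"
    and "\<And>i. t \<le> i \<Longrightarrow> i < n \<Longrightarrow> w (Suc i) \<le> w i"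
    and "\<And>m. t \<le> m \<Longrightarrow> m \<le> n \<Longrightarrow> (\<Sum>j=t..m. d j) \<ge> 0"
  shows "w n * (\<Sum>j=t..n. d j) \<le> (\<Sum>j=t..n. w j * d j)"
  using assms
proof (induction n rule: dec_induct)
  case base
  then show ?case by simp
next
  case (step n)
  have "w (Suc n) * (\<Sum>j=t..n. d j) \<le> w n * (\<Sum>j=t..n. d j)"
    using step by (intro mult_right_mono) auto
  moreover have "w n * (\<Sum>j=t..n. d j) \<le> (\<Sum>j=t..n. w j * d j)"
    using step by auto
  ultimately show ?case
    using step.hyps by (simp add: algebra_simps)
qed

text \<open>After taking logarithms, the tangent inequality bounds each difference below by
  \<open>d j / (x j - 1)\<close>. The slopes \<open>1 / (x j - 1)\<close> decrease because
  \<open>x\<close> increases, and \<open>dom\<close> makes the partial sums of \<open>d\<close>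
  positive, so Abel summation gives a positive total.\<close>

lemma prod_one_minus_inverse_less:
  fixes x y :: "nat \<Rightarrow> real"
  assumes "t < r"
    and x: "\<And>j. t \<le> j \<Longrightarrow> j < r \<Longrightarrow> x j > 1"
    and y: "\<And>j. t \<le> j \<Longrightarrow> j < r \<Longrightarrow> y j > 1"
    and mono: "\<And>i j. t \<le> i \<Longrightarrow> i \<le> j \<Longrightarrow> j < r \<Longrightarrow> x i \<le> x j"
    and dom: "\<And>m. t < m \<Longrightarrow> m \<le> r \<Longrightarrow> (\<Prod>j=t..<m. y j) < (\<Prod>j=t..<m. x j)"
  shows "(\<Prod>j=t..<r. 1 - 1 / y j) < (\<Prod>j=t..<r. 1 - 1 / x j)"
proof -
  obtain n where n: "r = Suc n" "t \<le> n" using \<open>t < r\<close> by (cases r) auto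
  define d where "d = (\<lambda>j. ln (x j) - ln (y j))"
  have d: "(\<Sum>j=t..m. d j) > 0" if "t \<le> m" "m \<le> n" for m
  proof -
    have "(\<Sum>j=t..m. ln (x j)) = ln (\<Prod>j=t..m. x j)"
      using that n x by (intro ln_prod[symmetric]) force+
    moreover have "(\<Sum>j=t..m. ln (y j)) = ln (\<Prod>j=t..m. y j)"
      using that n y by (intro ln_prod[symmetric]) force+
    moreover have "(\<Prod>j=t..m. y j) < (\<Prod>j=t..m. x j)"
      using dom[of "Suc m"] that n by (simp add: atLeastLessThanSuc_atLeastAtMost)
    moreover have "(\<Prod>j=t..m. y j) > 0"
      using y that n by (intro prod_pos) force
    ultimately show ?thesis by (simp add: d_def sum_subtractf)
  qed
  have "0 < 1 / (x n - 1) * (\<Sum>j=t..n. d j)"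
    using d[of n] n x[of n] by auto
  also have "\<dots> \<le> (\<Sum>j=t..n. 1 / (x j - 1) * d j)"
  proof (rule weighted_sum_ge)
    show "1 / (x (Suc i) - 1) \<le> 1 / (x i - 1)" if "t \<le> i" "i < n" for i
      using x[of i] mono[of i "Suc i"] that n by (intro divide_left_mono) auto
  qed (use n d in \<open>auto intro: less_imp_le\<close>)
  also have "\<dots> \<le> (\<Sum>j=t..n. ln (1 - 1 / x j) - ln (1 - 1 / y j))"
    using ln_one_minus_inverse_tangent x y n by (intro sum_mono) (auto simp: d_def)
  also have "\<dots> = ln (\<Prod>j=t..n. 1 - 1 / x j) - ln (\<Prod>j=t..n. 1 - 1 / y j)"
  proof -
    have "1 - 1 / x j \<noteq> 0" "1 - 1 / y j \<noteq> 0" if "j \<in> {t..n}" for j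
      using x[of j] y[of j] that n by auto
    then show ?thesis unfolding sum_subtractf by (subst (1 2) ln_prod) auto
  qed
  finally have "ln (\<Prod>j=t..n. 1 - 1 / y j) < ln (\<Prod>j=t..n. 1 - 1 / x j)" by simp
  moreover have "(\<Prod>j=t..n. 1 - 1 / y j) > 0" "(\<Prod>j=t..n. 1 - 1 / x j) > 0"
    using x y n by (force intro!: prod_pos)+
  ultimately show ?thesis
    using n by (simp add: atLeastLessThanSuc_atLeastAtMost)
qed

text \<open>The extremal sequence is y below, for which all hypotheses hold with equality. If the product
  exceeds the bound, take the last index t at which the partial product of x does not exceed that
  of y; from t on, x dominates y multiplicatively, which contradicts the hypothesis at t.\<close>

lemma prod_le_of_greedy_sequence:
  fixes x :: "nat \<Rightarrow> real"
  assumes "a > 0" "r > 0"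
    and x: "\<And>j. j < r \<Longrightarrow> x j > 1"
    and mono: "\<And>i j. i \<le> j \<Longrightarrow> j < r \<Longrightarrow> x i \<le> x j"
    and greedy: "\<And>t. t < r \<Longrightarrow>
      (\<Prod>j=t..<r. 1 - 1 / x j) \<le> (a * (\<Prod>j<t. x j)) / (a * (\<Prod>j<t. x j) + 1)"
  shows "a * (\<Prod>j<r. x j) \<le> (a + 1) ^ 2 ^ r - (a + 1) ^ 2 ^ (r - 1)"
proof (rule ccontr)
  assume contra: "\<not> ?thesis"
  define b where "b = a + 1"
  \<comment> \<open>A Sylvester-type choice: terms \<open>b ^ 2 ^ j + 1\<close> make
    \<open>Q t + 1\<close> equal to \<open>b ^ 2 ^ t\<close> for \<open>t < r\<close>. The last term
    is smaller by 1, so that the greedy condition holds with equality at the final index.\<close>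
  define y where "y = (\<lambda>j. if j = r - 1 then b ^ 2 ^ (r - 1) else b ^ 2 ^ j + 1)"
  define P where "P = (\<lambda>t. a * (\<Prod>j<t. x j))"
  define Q where "Q = (\<lambda>t. a * (\<Prod>j<t. y j))"
  have b: "b > 1" using \<open>a > 0\<close> by (simp add: b_def)
  have bp: "b ^ 2 ^ j > 1" for j :: nat using b by (simp add: one_less_power)
  have y: "y j > 1" for j using bp[of j] bp[of "r - 1"] by (simp add: y_def)
  have sq: "b ^ 2 ^ Suc j = b ^ 2 ^ j * b ^ 2 ^ j" for j :: nat
    by (simp add: mult_2 power_add)
  have Q: "Q t = b ^ 2 ^ t - 1" if "t < r" for t
    using that
  proof (induction t)
    case 0
    then show ?case by (simp add: Q_def b_def)
  next
    case (Suc t)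
    then have "y t = b ^ 2 ^ t + 1" by (auto simp: y_def)
    moreover have "Q (Suc t) = Q t * y t" by (simp add: Q_def)
    ultimately have "Q (Suc t) = (b ^ 2 ^ t - 1) * (b ^ 2 ^ t + 1)" using Suc by simp
    then show ?case unfolding sq by (simp add: algebra_simps)
  qed
  obtain n where n: "r = Suc n" using \<open>r > 0\<close> by (cases r) auto
  have "Q r = Q n * y n" by (simp add: Q_def n)
  also have "\<dots> = b ^ 2 ^ r - b ^ 2 ^ (r - 1)"
    unfolding n sq using Q[of n] by (simp add: n y_def left_diff_distrib)
  finally have Qr: "Q r = b ^ 2 ^ r - b ^ 2 ^ (r - 1)" .
  have tail: "(\<Prod>j=t..<r. 1 - 1 / y j) = Q t / (Q t + 1)" if "t \<le> n" for t
    using that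
  proof (induction t rule: inc_induct)
    case base
    then show ?case using Q[of n] bp[of n] b by (simp add: n y_def diff_divide_distrib)
  next
    case (step t)
    define B where "B = b ^ 2 ^ t"
    have B: "B > 1" using bp by (simp add: B_def)
    have "(\<Prod>j=t..<r. 1 - 1 / y j) = (1 - 1 / y t) * (\<Prod>j=Suc t..<r. 1 - 1 / y j)"
      using step n by (intro prod.atLeast_Suc_lessThan) auto
    also have "(\<Prod>j=Suc t..<r. 1 - 1 / y j) = (B * B - 1) / (B * B)"
      using step Q[of "Suc t"] n unfolding B_def sq[symmetric] by simp
    also have "y t = B + 1" using step n by (simp add: y_def B_def)
    also have "(1 - 1 / (B + 1)) * ((B * B - 1) / (B * B)) = (B - 1) / B"
      using B by (simp add: divide_simps) (simp add: algebra_simps)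
    also have "\<dots> = Q t / (Q t + 1)" using Q[of t] step n by (simp add: B_def)
    finally show ?case .
  qed
  have Ppos: "P t > 0" if "t \<le> r" for t
    using \<open>a > 0\<close> less_trans[OF zero_less_one x] that unfolding P_def
    by (intro mult_pos_pos prod_pos) auto
  have Qpos: "Q t > 0" for t
    unfolding Q_def using \<open>a > 0\<close> less_trans[OF zero_less_one y] by (intro mult_pos_pos prod_pos)
  \<comment> \<open>Index 0 qualifies, as both products equal \<open>a\<close> there; at
    \<open>r\<close> itself the negated goal gives the opposite inequality.\<close>
  define t where "t = Max {t. t < r \<and> P t \<le> Q t}"
  have ne: "{t. t < r \<and> P t \<le> Q t} \<noteq> {}" using \<open>r > 0\<close> by (auto simp: P_def Q_def)
  have fin: "finite {t. t < r \<and> P t \<le> Q t}" by simp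
  have t: "t < r" "P t \<le> Q t" using Max_in[OF fin ne] by (auto simp: t_def)
  have above: "P m > Q m" if "t < m" "m \<le> r" for m
  proof (cases "m = r")
    case True
    then show ?thesis using contra Qr by (simp add: P_def b_def)
  next
    case False
    then show ?thesis using that Max_ge[OF fin, of m] by (fastforce simp: t_def)
  qed
  have split: "(\<Prod>j<m. g j) = (\<Prod>j<t. g j) * (\<Prod>j=t..<m. g j)"
    if "t < m" for m and g :: "nat \<Rightarrow> real"
    using prod.atLeastLessThan_concat[of 0 t m g] that by (simp add: lessThan_atLeast0)
  have "(\<Prod>j=t..<r. 1 - 1 / y j) < (\<Prod>j=t..<r. 1 - 1 / x j)"
  proof (rule prod_one_minus_inverse_less[OF \<open>t < r\<close>])
    show "(\<Prod>j=t..<m. y j) < (\<Prod>j=t..<m. x j)" if "t < m" "m \<le> r" for m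
    proof -
      have "0 < (\<Prod>j=t..<m. y j)" using less_trans[OF zero_less_one y] by (intro prod_pos)
      then have "P t * (\<Prod>j=t..<m. y j) \<le> Q t * (\<Prod>j=t..<m. y j)"
        using t(2) by (intro mult_right_mono) auto
      also have "\<dots> = Q m" by (simp add: Q_def split[OF that(1)])
      also have "\<dots> < P m" using above that by blast
      also have "\<dots> = P t * (\<Prod>j=t..<m. x j)" by (simp add: P_def split[OF that(1)])
      finally show ?thesis using Ppos[of t] t by simp
    qed
  qed (use x y mono in auto)
  also have "\<dots> \<le> P t / (P t + 1)" using greedy t by (simp add: P_def)
  also have "\<dots> \<le> Q t / (Q t + 1)"
    using t Ppos[of t] Qpos[of t] by (simp add: divide_simps algebra_simps)
  finally show False using tail[of t] t n by simp
qed

section \<open>Selecting a subset in increasing order\<close>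

lemma prod_exchange_le:
  fixes f :: "'a \<Rightarrow> real"
  assumes "finite U" "I \<subseteq> U" "W \<subseteq> U" "card I = card W"
    and le: "\<And>i j. i \<in> I \<Longrightarrow> j \<in> U - I \<Longrightarrow> f i \<le> f j"
    and pos: "\<And>i. i \<in> U \<Longrightarrow> f i > 0"
  shows "prod f I \<le> prod f W"
proof -
  have fin: "finite I" "finite W" using assms finite_subset by auto
  have card: "card (I - W) = card (W - I)"
    using card_Diff_subset_Int[of I W] card_Diff_subset_Int[of W I] fin assms
    by (simp add: Int_commute)
  have "prod f (I - W) \<le> prod f (W - I)"
  proof (cases "I - W = {}")
    case True
    then have "W - I = {}" using card fin by (metis card.empty card_0_eq finite_Diff)
    then show ?thesis using True by (metis order_refl)
  next
    case False
    \<comment> \<open>By \<open>le\<close>, the largest value on \<open>I - W\<close> is at most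
      every value on \<open>W - I\<close>; since both sets have the same size, a power of
      \<open>m\<close> separates the two products.\<close>
    define m where "m = Max (f ` (I - W))"
    have m: "m \<in> f ` (I - W)" using False fin unfolding m_def by (intro Max_in) auto
    have "prod f (I - W) \<le> (\<Prod>i\<in>I - W. m)"
      using fin pos assms(2) by (intro prod_mono) (auto simp: m_def less_imp_le subset_iff)
    also have "\<dots> = (\<Prod>i\<in>W - I. m)" using card by simp
    also have "\<dots> \<le> prod f (W - I)"
    proof (intro prod_mono conjI)
      show "0 \<le> m" if "i \<in> W - I" for i using m pos assms(2) by (auto intro: less_imp_le)
      show "m \<le> f i" if "i \<in> W - I" for i using m le that assms(3) by auto
    qed
    finally show ?thesis .
  qed
  moreover have "prod f I = prod f (I \<inter> W) * prod f (I - W)"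
    using prod.Int_Diff[OF fin(1)] by auto
  moreover have "prod f W = prod f (I \<inter> W) * prod f (W - I)"
    using prod.Int_Diff[OF fin(2), of f I] by (simp add: Int_commute)
  moreover have "prod f (I \<inter> W) \<ge> 0" using pos assms(2) by (intro prod_nonneg) (auto intro: less_imp_le)
  ultimately show ?thesis by (simp add: mult_left_mono)
qed

text \<open>Elements are taken in increasing order of \<open>f\<close> until \<open>stop\<close>
  first holds. For the last bound the sequence lemma is restarted after the \<open>card W\<close>
  smallest elements, whose product is at most that of \<open>W\<close> by the exchange lemma. The
  predicate \<open>stop\<close> is abstract so that V may cross 1 in either direction.\<close>

lemma greedy_subset:
  fixes f :: "'a \<Rightarrow> real" and a :: real
  assumes fin: "finite X" and "a > 0"
    and f: "\<And>p. p \<in> X \<Longrightarrow> f p > 1"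
    and stop: "\<not> stop {}" "stop X"
    and greedy: "\<And>W W'. W \<subseteq> W' \<Longrightarrow> W' \<subseteq> X \<Longrightarrow> \<not> stop W \<Longrightarrow> stop W' \<Longrightarrow>
      (\<Prod>p\<in>W' - W. 1 - 1 / f p) \<le> (a * prod f W) / (a * prod f W + 1)"
  obtains U where "U \<subseteq> X" "U \<noteq> {}" "stop U"
    "a * prod f U \<le> (a + 1) ^ 2 ^ card U - (a + 1) ^ 2 ^ (card U - 1)"
    "\<And>W. W \<subseteq> U \<Longrightarrow> a * prod f U + 1 \<le> (a * prod f W + 1) ^ 2 ^ (card U - card W)"
proof -
  obtain xs0 where xs0: "set xs0 = X" "distinct xs0" using finite_distinct_list[OF fin] by blast
  define xs where "xs = sort_key f xs0"
  have xs: "set xs = X" "distinct xs" "sorted (map f xs)" using xs0 by (auto simp: xs_def)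
  define x where "x = (\<lambda>j. f (xs ! j))"
  \<comment> \<open>\<open>G t\<close> holds the \<open>t\<close> smallest elements, and
    \<open>r\<close> is the first size at which \<open>stop\<close> holds.\<close>
  define G where "G = (\<lambda>t. (!) xs ` {..<t})"
  define r where "r = (LEAST t. stop (G t))"
  have "G (length xs) = X" using xs(1) by (auto simp: G_def in_set_conv_nth image_iff)
  then have ex: "stop (G (length xs))" using stop by simp
  have r: "stop (G r)" unfolding r_def using ex by (rule LeastI)
  have rn: "r \<le> length xs" unfolding r_def using ex by (rule Least_le)
  have nstop: "\<not> stop (G t)" if "t < r" for t using not_less_Least that by (auto simp: r_def)
  have "r > 0" using r stop by (cases r) (auto simp: G_def)
  have inj: "inj_on ((!) xs) S" if "S \<subseteq> {..<r}" for S
    using inj_on_nth[OF xs(2), of S] that rn by force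
  have prodG: "(\<Prod>p\<in>(!) xs ` S. g (f p)) = (\<Prod>j\<in>S. g (x j))" if "S \<subseteq> {..<r}" for S and g :: "real \<Rightarrow> real"
    using prod.reindex[OF inj[OF that]] by (simp add: x_def)
  have prodG': "prod f (G t) = (\<Prod>j<t. x j)" if "t \<le> r" for t
    using prodG[of "{..<t}" id] that by (simp add: G_def)
  have cardG: "card (G t) = t" if "t \<le> r" for t
    using card_image[OF inj[of "{..<t}"]] that by (simp add: G_def)
  have GX: "G r \<subseteq> X" using xs rn by (auto simp: G_def)
  have x1: "x j > 1" if "j < r" for j using f[of "xs ! j"] nth_mem[of j xs] xs(1) rn that by (simp add: x_def)
  have xmono: "x i \<le> x j" if "i \<le> j" "j < r" for i j
    using sorted_nth_mono[OF xs(3), of i j] that rn by (simp add: x_def)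
  have diffG: "G r - G t = (!) xs ` {t..<r}" if "t < r" for t
  proof -
    have "G r - G t = (!) xs ` ({..<r} - {..<t})"
      unfolding G_def using that by (intro inj_on_image_set_diff[OF inj[OF order_refl], symmetric]) auto
    also have "{..<r} - {..<t} = {t..<r}" by auto
    finally show ?thesis .
  qed
  have step: "(\<Prod>j=t..<r. 1 - 1 / x j) \<le> (a * (\<Prod>j<t. x j)) / (a * (\<Prod>j<t. x j) + 1)"
    if "t < r" for t
  proof -
    have "G t \<subseteq> G r" using that by (auto simp: G_def)
    from greedy[OF this GX nstop[OF that] r] show ?thesis
      unfolding diffG[OF that] using that
      by (subst (asm) prodG[of _ "\<lambda>z. 1 - 1 / z"]) (auto simp: prodG')
  qed
  have tail: "a * prod f (G r) \<le> (a * prod f (G w) + 1) ^ 2 ^ (r - w) - (a * prod f (G w) + 1) ^ 2 ^ (r - w - 1)"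
    if "w < r" for w
  proof -
    \<comment> \<open>The first \<open>w\<close> factors are absorbed into the constant, so the
      sequence lemma applies to the remaining \<open>r - w\<close>.\<close>
    define a' where "a' = a * prod f (G w)"
    have "a' > 0" unfolding a'_def prodG'[OF less_imp_le[OF that]] using \<open>a > 0\<close> less_trans[OF zero_less_one x1] that
      by (intro mult_pos_pos prod_pos) auto
    have split: "a * (\<Prod>j<w + t. x j) = a' * (\<Prod>j<t. x (w + j))" if "w + t \<le> r" for t
    proof -
      have "(\<Prod>j<w + t. x j) = (\<Prod>j<w. x j) * (\<Prod>j=w..<w + t. x j)"
        using prod.atLeastLessThan_concat[of 0 w "w + t" x] by (simp add: lessThan_atLeast0)
      also have "(\<Prod>j=w..<w + t. x j) = (\<Prod>j<t. x (w + j))"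
        using prod.atLeastLessThan_shift_0[of x w "w + t"] by (simp add: lessThan_atLeast0 comp_def)
      finally show ?thesis using that by (simp add: a'_def prodG')
    qed
    have "a' * (\<Prod>j<r - w. x (w + j)) \<le> (a' + 1) ^ 2 ^ (r - w) - (a' + 1) ^ 2 ^ (r - w - 1)"
    proof (rule prod_le_of_greedy_sequence[OF \<open>a' > 0\<close>])
      fix t assume t: "t < r - w"
      have "(\<Prod>j=t..<r - w. 1 - 1 / x (w + j)) = (\<Prod>j=w + t..<r. 1 - 1 / x j)"
        using prod.shift_bounds_nat_ivl[of "\<lambda>j. 1 - 1 / x j" t w "r - w"] that
        by (simp add: add.commute)
      then show "(\<Prod>j=t..<r - w. 1 - 1 / x (w + j)) \<le>
          a' * (\<Prod>j<t. x (w + j)) / (a' * (\<Prod>j<t. x (w + j)) + 1)"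
        using step[of "w + t"] split[of t] t by simp
    qed (use that x1 xmono in auto)
    moreover have "a * prod f (G r) = a' * (\<Prod>j<r - w. x (w + j))"
      using split[of "r - w"] that by (simp add: prodG')
    ultimately show ?thesis by (simp only: a'_def)
  qed
  have pos: "f i > 0" if "i \<in> G r" for i using f GX that by force
  show thesis
  proof (rule that[of "G r"])
    show "G r \<noteq> {}" using \<open>r > 0\<close> by (auto simp: G_def)
    show "a * prod f (G r) \<le> (a + 1) ^ 2 ^ card (G r) - (a + 1) ^ 2 ^ (card (G r) - 1)"
      using tail[OF \<open>r > 0\<close>] cardG[of r] by (simp add: G_def)
    fix W assume W: "W \<subseteq> G r"
    define w where "w = card W"
    have fG: "finite (G r)" by (simp add: G_def)
    have "w \<le> r" using card_mono[OF fG W] cardG[of r] by (simp add: w_def)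
    show "a * prod f (G r) + 1 \<le> (a * prod f W + 1) ^ 2 ^ (card (G r) - card W)"
    proof (cases "w = r")
      case True
      then have "W = G r" using card_subset_eq[OF fG W] cardG[of r] by (simp add: w_def)
      then show ?thesis by simp
    next
      case False
      then have "w < r" using \<open>w \<le> r\<close> by simp
      have le: "prod f (G w) \<le> prod f W"
      proof (rule prod_exchange_le[OF fG _ W])
        show "card (G w) = card W" using cardG[OF \<open>w \<le> r\<close>] by (simp add: w_def)
        show "f i \<le> f j" if "i \<in> G w" "j \<in> G r - G w" for i j
          using that xmono unfolding diffG[OF \<open>w < r\<close>] by (auto simp: G_def x_def)
      qed (use \<open>w \<le> r\<close> pos in \<open>auto simp: G_def\<close>)
      have "0 \<le> a * prod f (G w)"
        using \<open>a > 0\<close> pos \<open>w \<le> r\<close> by (intro mult_nonneg_nonneg prod_nonneg) (auto simp: G_def less_imp_le)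
      \<comment> \<open>The power subtracted in \<open>tail\<close> is at least 1 and pays for the
        \<open>+ 1\<close> on the left.\<close>
      then have "1 \<le> (a * prod f (G w) + 1) ^ 2 ^ (r - w - 1)"
        by (intro one_le_power) simp
      then have "a * prod f (G r) + 1 \<le> (a * prod f (G w) + 1) ^ 2 ^ (r - w)"
        using tail[OF \<open>w < r\<close>] by linarith
      also have "\<dots> \<le> (a * prod f W + 1) ^ 2 ^ (r - w)"
        using le \<open>a > 0\<close> \<open>0 \<le> a * prod f (G w)\<close> by (intro power_mono) auto
      finally show ?thesis using cardG[of r] by (simp add: w_def)
    qed
  qed (use GX r in auto)
qed

subsection \<open>Known and resolved primes\<close>

text \<open>For a prime \<open>p\<close> this is the divisor sum of \<open>p ^ n\<close>; see
  \<open>divisor_sigma_prime_power\<close>.\<close>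

definition geometric_sum :: "nat \<Rightarrow> nat \<Rightarrow> nat" where
  "geometric_sum p n = (\<Sum>j\<le>n. p ^ j)"

lemma real_geometric_sum:
  assumes "p > 1"
  shows "real (geometric_sum p n) = (real p ^ Suc n - 1) / (real p - 1)"
  using geometric_sum[of "real p" "Suc n"] assms
  by (simp add: geometric_sum_def lessThan_Suc_atMost)

lemma geometric_sum_pos: "p > 0 \<Longrightarrow> geometric_sum p n > 0"
  by (auto simp: geometric_sum_def intro!: sum_pos)

lemma geometric_sum_gt:
  assumes "p > 1" "n > 0"
  shows "p ^ n < geometric_sum p n"
proof -
  obtain m where "n = Suc m" using assms by (cases n) auto
  then show ?thesis
    using geometric_sum_pos[of p m] assms by (simp add: geometric_sum_def)
qed

text \<open>\<open>A i\<close> stands for the set of primes dividing M_i and \<open>e p\<close> for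
  the exponent of \<open>p\<close>; one function \<open>e\<close> suffices because the sets are
  disjoint. The condition \<open>amicable\<close> is the sum of M_i / sigma(M_i), and
  \<open>coprime_geometric_sum\<close> is what remains of the coprimality of product and
  sum.\<close>

locale amicable_factorization =
  fixes I :: "'i set" and A :: "'i \<Rightarrow> nat set" and e :: "nat \<Rightarrow> nat"
  assumes finite_I: "finite I" and card_I: "card I \<ge> 2"
    and finite_A: "i \<in> I \<Longrightarrow> finite (A i)"
    and disjoint_A: "i \<in> I \<Longrightarrow> j \<in> I \<Longrightarrow> i \<noteq> j \<Longrightarrow> A i \<inter> A j = {}"
    and prime_A: "i \<in> I \<Longrightarrow> p \<in> A i \<Longrightarrow> prime p"
    and e_pos: "i \<in> I \<Longrightarrow> p \<in> A i \<Longrightarrow> e p > 0"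
    and coprime_geometric_sum: "i \<in> I \<Longrightarrow> j \<in> I \<Longrightarrow> p \<in> A i \<Longrightarrow> q \<in> A j \<Longrightarrow>
      coprime (geometric_sum p (e p)) q"
    and amicable: "(\<Sum>i\<in>I. \<Prod>p\<in>A i. real (p ^ e p) / real (geometric_sum p (e p))) = 1"
begin

definition P :: "nat set" where "P = (\<Union>i\<in>I. A i)"

text \<open>Below, T is the set of known primes and R, a subset of T, that of resolved ones.\<close>

definition num :: "nat set \<Rightarrow> nat set \<Rightarrow> nat \<Rightarrow> nat" where
  "num T R p = (if p \<in> R then p ^ e p else if p \<in> T then p - 1 else 1)"

text \<open>Kept as a natural number apart from \<open>num\<close>, so that the product
  \<open>D\<close> is a concrete common denominator of \<open>V\<close>.\<close>

definition den :: "nat set \<Rightarrow> nat set \<Rightarrow> nat \<Rightarrow> nat" where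
  "den T R p = (if p \<in> R then geometric_sum p (e p) else if p \<in> T then p else 1)"

definition weight :: "nat set \<Rightarrow> nat set \<Rightarrow> nat \<Rightarrow> real" where
  "weight T R p = real (num T R p) / real (den T R p)"

definition V :: "nat set \<Rightarrow> nat set \<Rightarrow> real" where
  "V T R = (\<Sum>i\<in>I. \<Prod>p\<in>A i. weight T R p)"

definition D :: "nat set \<Rightarrow> nat set \<Rightarrow> nat" where
  "D T R = (\<Prod>p\<in>P. den T R p)"

lemma finite_P [simp]: "finite P"
  using finite_I finite_A by (auto simp: P_def)

lemma prime_P: "p \<in> P \<Longrightarrow> prime p"
  using prime_A by (auto simp: P_def)

lemma P_gt_1: "p \<in> P \<Longrightarrow> p > 1"
  using prime_P prime_gt_1_nat by blast

lemma e_pos_P: "p \<in> P \<Longrightarrow> e p > 0"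
  using e_pos by (auto simp: P_def)

lemma A_subset_P: "i \<in> I \<Longrightarrow> A i \<subseteq> P"
  by (auto simp: P_def)

lemma I_nonempty: "I \<noteq> {}"
  using card_I by auto

lemma den_pos: "p \<in> P \<Longrightarrow> den T R p > 0"
  using P_gt_1[of p] by (auto simp: den_def geometric_sum_pos)

lemma num_pos: "p \<in> P \<Longrightarrow> num T R p > 0"
  using P_gt_1[of p] by (auto simp: num_def)

lemma weight_pos: "p \<in> P \<Longrightarrow> weight T R p > 0"
  using den_pos num_pos by (simp add: weight_def)

lemma D_pos: "D T R > 0"
  unfolding D_def using den_pos by (auto intro!: prod_pos)

lemma weight_nonneg: "p \<in> P \<Longrightarrow> weight T R p \<ge> 0"
  using weight_pos less_imp_le by blast

lemma V_pos: "V T R > 0"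
  unfolding V_def using finite_I I_nonempty weight_pos A_subset_P[THEN subsetD]
  by (intro sum_pos prod_pos) blast+

lemma weight_resolved:
  assumes "p \<in> P" "p \<in> R"
  shows "weight T R p = real p ^ e p * (real p - 1) / (real p ^ Suc (e p) - 1)"
  using assms P_gt_1[of p] by (simp add: weight_def num_def den_def real_geometric_sum)

lemma weight_known: "p \<in> P \<Longrightarrow> p \<in> T \<Longrightarrow> p \<notin> R \<Longrightarrow> weight T R p = 1 - 1 / real p"
  using P_gt_1[of p] by (simp add: weight_def num_def den_def of_nat_diff field_simps)

lemma weight_unknown: "p \<notin> T \<Longrightarrow> p \<notin> R \<Longrightarrow> weight T R p = 1"
  by (simp add: weight_def num_def den_def)

lemma power_gt_1: "p \<in> P \<Longrightarrow> real p ^ Suc n > 1"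
  using P_gt_1[of p] by (intro one_less_power) auto

text \<open>Resolving a known prime divides its factor by 1 - 1/p^(e+1), which again has the form 1
  - 1/x that the greedy lemma handles.\<close>

lemma weight_known_eq:
  assumes "p \<in> P" "p \<in> T" "p \<notin> R" "p \<in> R'"
  shows "weight T R p = (1 - 1 / real p ^ Suc (e p)) * weight T' R' p"
  using assms P_gt_1[of p] power_gt_1[of p "e p"]
  by (simp add: weight_known weight_resolved divide_simps)

lemma weight_known_less_resolved:
  assumes "p \<in> P" "p \<in> T" "p \<notin> R" "p \<in> R'"
  shows "weight T R p < weight T' R' p"
proof -
  have "(1 - 1 / real p ^ Suc (e p)) * weight T' R' p < 1 * weight T' R' p"
    using weight_pos[OF assms(1)] P_gt_1[OF assms(1)] by (intro mult_strict_right_mono) auto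
  then show ?thesis using weight_known_eq[OF assms, of T'] by simp
qed

lemma weight_resolved_less_1:
  assumes "p \<in> P" "p \<in> R"
  shows "weight T R p < 1"
  using assms geometric_sum_gt[OF P_gt_1 e_pos_P, of p] geometric_sum_pos[of p "e p"] P_gt_1[of p]
  by (simp add: weight_def num_def den_def divide_less_eq_1 del: of_nat_power)

text \<open>A summand absorbs the factors \<open>l p\<close> with \<open>p\<close> in its own
  \<open>A i\<close>; the others are at most 1 and only lower the left side. A single product over
  \<open>P\<close> thus serves all summands.\<close>

lemma V_scale:
  assumes "\<And>p. p \<in> P \<Longrightarrow> 0 \<le> l p \<and> l p \<le> 1 \<and> l p * weight T R p \<le> weight T' R' p"
  shows "(\<Prod>p\<in>P. l p) * V T R \<le> V T' R'"
proof -
  have "(\<Prod>p\<in>P. l p) * (\<Prod>p\<in>A i. weight T R p) \<le> (\<Prod>p\<in>A i. weight T' R' p)" if "i \<in> I" for i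
  proof -
    have sub: "A i \<subseteq> P" using A_subset_P that by blast
    have "(\<Prod>p\<in>P. l p) = (\<Prod>p\<in>P - A i. l p) * (\<Prod>p\<in>A i. l p)"
      using prod.subset_diff[OF sub finite_P] .
    also have "\<dots> \<le> 1 * (\<Prod>p\<in>A i. l p)"
      using assms sub by (intro mult_right_mono prod_le_1 prod_nonneg) auto
    finally have "(\<Prod>p\<in>P. l p) * (\<Prod>p\<in>A i. weight T R p) \<le>
        (\<Prod>p\<in>A i. l p) * (\<Prod>p\<in>A i. weight T R p)"
      using sub weight_nonneg by (intro mult_right_mono prod_nonneg) auto
    also have "\<dots> = (\<Prod>p\<in>A i. l p * weight T R p)" by (simp add: prod.distrib)
    also have "\<dots> \<le> (\<Prod>p\<in>A i. weight T' R' p)"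
      using assms sub weight_nonneg by (intro prod_mono) (auto intro!: mult_nonneg_nonneg)
    finally show ?thesis .
  qed
  then show ?thesis unfolding V_def sum_distrib_left by (intro sum_mono)
qed

lemma V_less:
  assumes "\<And>p. p \<in> P \<Longrightarrow> weight T R p \<le> weight T' R' p"
    and "q \<in> P" "weight T R q < weight T' R' q"
  shows "V T R < V T' R'"
proof -
  obtain i where i: "i \<in> I" "q \<in> A i" using assms(2) by (auto simp: P_def)
  have "(\<Prod>p\<in>A i. weight T R p) < (\<Prod>p\<in>A i. weight T' R' p)"
  proof -
    have "(\<Prod>p\<in>A i - {q}. weight T R p) \<le> (\<Prod>p\<in>A i - {q}. weight T' R' p)"
      using assms A_subset_P[OF i(1)] weight_nonneg by (intro prod_mono) auto
    moreover have "(\<Prod>p\<in>A i - {q}. weight T' R' p) > 0"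
      using A_subset_P[OF i(1)] weight_pos by (intro prod_pos) auto
    ultimately have "weight T R q * (\<Prod>p\<in>A i - {q}. weight T R p) <
        weight T' R' q * (\<Prod>p\<in>A i - {q}. weight T' R' p)"
      using assms(3) weight_pos[OF assms(2), of T R]
      by (meson less_imp_le mult_left_mono mult_strict_right_mono order_le_less_trans)
    then show ?thesis using i finite_A by (simp add: prod.remove)
  qed
  moreover have "(\<Prod>p\<in>A j. weight T R p) \<le> (\<Prod>p\<in>A j. weight T' R' p)" if "j \<in> I" for j
    using assms A_subset_P[OF that] weight_nonneg by (intro prod_mono) auto
  ultimately show ?thesis unfolding V_def using finite_I i by (intro sum_strict_mono_ex1) auto
qed

section \<open>Extreme values of V\<close>

lemma V_all: "V T P = 1"
proof -
  have "(\<Prod>p\<in>A i. weight T P p) = (\<Prod>p\<in>A i. real (p ^ e p) / real (geometric_sum p (e p)))"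
    if "i \<in> I" for i
    using A_subset_P[OF that] by (intro prod.cong) (auto simp: weight_def num_def den_def)
  then show ?thesis using amicable by (simp add: V_def)
qed

text \<open>Resolving a known prime raises its factor, and full resolution gives 1. Hence making all
  primes known brings \<open>V\<close> down to at most 1, so the first half of a cycle always
  stops.\<close>

lemma V_all_known_less:
  assumes "R \<subset> P"
  shows "V P R < 1"
proof -
  obtain q where q: "q \<in> P" "q \<notin> R" using assms by blast
  have "V P R < V P P"
  proof (rule V_less[OF _ q(1)])
    show "weight P R p \<le> weight P P p" if "p \<in> P" for p
      using weight_known_less_resolved[of p P R P P] that
      by (cases "p \<in> R") (auto simp: weight_resolved intro: less_imp_le)
  qed (use q weight_known_less_resolved in auto)
  then show ?thesis by (simp add: V_all)
qed

lemma V_all_known_le: "R \<subseteq> P \<Longrightarrow> V P R \<le> 1"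
  using V_all_known_less[of R] V_all[of P] by (metis less_imp_le order_refl psubsetI)

text \<open>A resolved factor is below 1, an unknown one equals 1. Hence resolving all known primes
  brings \<open>V\<close> up to at least 1, so the second half of a cycle always stops.\<close>

lemma V_unknown_greater:
  assumes "R \<subset> P"
  shows "V R R > 1"
proof -
  obtain q where q: "q \<in> P" "q \<notin> R" using assms by blast
  have "V P P < V R R"
  proof (rule V_less[OF _ q(1)])
    show "weight P P p \<le> weight R R p" if "p \<in> P" for p
      using weight_resolved_less_1[of p P P] that
      by (cases "p \<in> R") (auto simp: weight_resolved weight_unknown intro: less_imp_le)
  qed (use q weight_resolved_less_1[of q P P] in \<open>auto simp: weight_unknown\<close>)
  then show ?thesis by (simp add: V_all)
qed

section \<open>Integrality of V over its common denominator\<close>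

lemma prod_restrict_P:
  fixes g :: "nat \<Rightarrow> 'b :: comm_monoid_mult"
  assumes "W \<subseteq> P"
  shows "(\<Prod>p\<in>P. if p \<in> W then g p else 1) = (\<Prod>p\<in>W. g p)"
  using assms finite_P by (simp add: prod.inter_restrict[symmetric] Int_absorb1)

text \<open>The numerator of \<open>V\<close> over the denominator \<open>D\<close>. As it is a
  natural number, \<open>V\<close> differs from 1 by at least \<open>1 / D\<close> unless it equals
  1.\<close>

definition Z :: "nat set \<Rightarrow> nat set \<Rightarrow> nat" where
  "Z T R = (\<Sum>i\<in>I. \<Prod>p\<in>P. if p \<in> A i then num T R p else den T R p)"

lemma Z_eq: "real (Z T R) = real (D T R) * V T R"
proof -
  have "real (\<Prod>p\<in>P. if p \<in> A i then num T R p else den T R p) =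
      real (D T R) * (\<Prod>p\<in>A i. weight T R p)" if "i \<in> I" for i
  proof -
    have "(\<Prod>p\<in>A i. weight T R p) = (\<Prod>p\<in>P. if p \<in> A i then weight T R p else 1)"
      by (rule prod_restrict_P[OF A_subset_P[OF that], symmetric])
    then show ?thesis
      unfolding D_def of_nat_prod prod.distrib[symmetric]
      using den_pos by (auto simp: prod.distrib[symmetric] weight_def intro!: prod.cong)
  qed
  then show ?thesis unfolding Z_def V_def of_nat_sum sum_distrib_left by (intro sum.cong) auto
qed

lemma V_ge_if_greater:
  assumes "V T R > 1"
  shows "V T R \<ge> 1 + 1 / real (D T R)"
proof -
  have "real (D T R) < real (Z T R)" using assms D_pos[of T R] by (simp add: Z_eq)
  then have "real (D T R) + 1 \<le> real (D T R) * V T R" by (simp flip: Z_eq)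
  then show ?thesis using D_pos[of T R] by (simp add: field_simps)
qed

lemma V_le_if_less:
  assumes "V T R < 1"
  shows "V T R \<le> 1 - 1 / real (D T R)"
proof -
  have "real (Z T R) < real (D T R)" using assms D_pos[of T R] by (simp add: Z_eq)
  then have "real (D T R) * V T R + 1 \<le> real (D T R)" by (simp flip: Z_eq)
  then show ?thesis using D_pos[of T R] by (simp add: field_simps)
qed

text \<open>The largest known but unresolved prime q divides the denominator of exactly one summand
  of V, and it divides no numerator there.\<close>

lemma V_eq_1D:
  assumes "R \<subseteq> T" "T \<subseteq> P" "V T R = 1"
  shows "R = P"
proof (cases "R = T")
  case True
  \<comment> \<open>With every known prime resolved, \<open>V\<close> exceeds 1 unless
    \<open>R\<close> is all of \<open>P\<close>.\<close>
  then show ?thesis using assms V_unknown_greater[of R] by (cases "R = P") auto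
next
  case False
  have fin: "finite (T - R)" using assms finite_subset[OF _ finite_P] by blast
  define q where "q = Max (T - R)"
  have q: "q \<in> T" "q \<notin> R" using Max_in[OF fin] False assms unfolding q_def by auto
  have qmax: "p \<le> q" if "p \<in> T" "p \<notin> R" for p
    using Max_ge[OF fin, of p] that by (auto simp: q_def)
  have "q \<in> P" using q assms by blast
  then have pq: "prime q" using prime_P by blast
  obtain i where i: "i \<in> I" "q \<in> A i" using \<open>q \<in> P\<close> by (auto simp: P_def)
  define g where "g = (\<lambda>j. \<Prod>p\<in>P. if p \<in> A j then num T R p else den T R p)"
  have den_dvd: "q dvd den T R q" using q by (simp add: den_def)
  have "Z T R = D T R" using Z_eq[of T R] assms(3) by simp
  \<comment> \<open>\<open>D\<close> and all terms other than \<open>g i\<close> are divisible by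
    \<open>q\<close>, which forces \<open>q\<close> to divide \<open>g i\<close>.\<close>
  then have sum: "D T R = g i + (\<Sum>j\<in>I - {i}. g j)"
    using finite_I i by (simp add: Z_def g_def sum.remove)
  have "q dvd D T R"
    unfolding D_def using \<open>q \<in> P\<close> den_dvd by (meson dvd_prodI dvd_trans finite_P)
  moreover have "q dvd g j" if "j \<in> I - {i}" for j
  proof -
    have "q \<notin> A j" using disjoint_A[of i j] i that by auto
    then have "q dvd (if q \<in> A j then num T R q else den T R q)" using den_dvd by simp
    also have "\<dots> dvd g j"
      unfolding g_def using \<open>q \<in> P\<close> by (intro dvd_prodI) auto
    finally show ?thesis .
  qed
  ultimately have "q dvd g i"
    unfolding sum using dvd_sum[of "I - {i}" q g] by (metis dvd_add_left_iff)
  then obtain p where p: "p \<in> P" "q dvd (if p \<in> A i then num T R p else den T R p)"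
    unfolding g_def using pq by (auto simp: prime_dvd_prod_iff)
  have "\<not> q dvd geometric_sum p (e p)"
    using p(1) \<open>q \<in> P\<close> coprime_geometric_sum pq
    by (auto simp: P_def) (metis coprime_absorb_right not_prime_unit)
  moreover have "\<not> q dvd p ^ e p" if "p \<noteq> q"
    using that pq prime_P[OF p(1)] prime_dvd_power primes_dvd_imp_eq by blast
  \<comment> \<open>Maximality of \<open>q\<close> enters here: \<open>p - 1\<close> is positive and
    smaller than \<open>q\<close>.\<close>
  moreover have "\<not> q dvd p - 1" if "p \<in> T" "p \<notin> R"
    using qmax[OF that] P_gt_1[OF p(1)] by (intro nat_dvd_not_less) auto
  moreover have "\<not> q dvd p" if "p \<noteq> q"
    using that pq prime_P[OF p(1)] primes_dvd_imp_eq by blast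
  moreover have "\<not> q dvd 1" using pq not_prime_unit by blast
  ultimately show ?thesis using p(2) q i by (auto simp: num_def den_def split: if_splits)
qed

section \<open>Growth of the denominator\<close>

lemma D_add_known:
  assumes "T \<subseteq> P" "R \<subseteq> T" "U \<subseteq> P - T"
  shows "D (T \<union> U) R = D T R * \<Prod>U"
proof -
  have "\<Prod>U = (\<Prod>p\<in>P. if p \<in> U then p else 1)"
    using assms by (intro prod_restrict_P[symmetric]) auto
  then show ?thesis
    unfolding D_def using assms by (auto simp: prod.distrib[symmetric] den_def intro!: prod.cong)
qed

text \<open>Resolving replaces the factor \<open>p\<close> of \<open>D\<close> by (p^(e+1) - 1) / (p
  - 1); the identity is cross-multiplied to avoid division.\<close>

lemma D_resolve:
  assumes "W \<subseteq> T - R" "T \<subseteq> P"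
  shows "real (D T (R \<union> W)) * (\<Prod>p\<in>W. real p * (real p - 1)) =
    real (D T R) * (\<Prod>p\<in>W. real p ^ Suc (e p) - 1)"
proof -
  have WP: "W \<subseteq> P" using assms by auto
  have ext: "(\<Prod>p\<in>W. g p) = (\<Prod>p\<in>P. if p \<in> W then g p else 1)" for g :: "nat \<Rightarrow> real"
    by (rule prod_restrict_P[OF WP, symmetric])
  have "real (den T (R \<union> W) p) * (if p \<in> W then real p * (real p - 1) else 1) =
      real (den T R p) * (if p \<in> W then real p ^ Suc (e p) - 1 else 1)" if "p \<in> P" for p
    using assms P_gt_1[OF that] by (auto simp: den_def real_geometric_sum)
  then show ?thesis
    unfolding ext D_def of_nat_prod prod.distrib[symmetric] by (intro prod.cong) auto
qed

section \<open>The two halves of a cycle\<close>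

lemma finite_subset_P: "T \<subseteq> P \<Longrightarrow> finite T"
  using finite_subset finite_P by blast

lemma card_subset_P: "T \<subseteq> P \<Longrightarrow> card T \<le> card P"
  by (intro card_mono) auto

text \<open>Before the crossing \<open>V\<close> is at least 1 + 1/d, where d is the current
  denominator; afterwards it is at most 1. So the factors added in between multiply to at most d /
  (d + 1), the greedy condition with \<open>a = D T R\<close> and \<open>f = real\<close>.\<close>

lemma add_primes:
  assumes RT: "R \<subseteq> T" and TP: "T \<subseteq> P" and V: "V T R > 1"
  obtains U where "U \<subseteq> P - T" "U \<noteq> {}" "V (T \<union> U) R \<le> 1"
    "real (D (T \<union> U) R) \<le> (real (D T R) + 1) ^ 2 ^ card U - (real (D T R) + 1) ^ 2 ^ (card U - 1)"
    "\<And>W. W \<subseteq> U \<Longrightarrow>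
      real (D (T \<union> U) R) + 1 \<le> (real (D T R) * real (\<Prod>W) + 1) ^ 2 ^ (card U - card W)"
proof -
  have Dreal: "real (D (T \<union> U) R) = real (D T R) * prod real U" if "U \<subseteq> P - T" for U
    using D_add_known[OF TP RT that] by simp
  \<comment> \<open>\<open>g1\<close> to \<open>g6\<close> are the premises of
    \<open>greedy_subset\<close>.\<close>
  have g1: "finite (P - T)" by simp
  have g2: "real (D T R) > 0" using D_pos by simp
  have g3: "real p > 1" if "p \<in> P - T" for p using P_gt_1 that by auto
  have g4: "\<not> V (T \<union> {}) R \<le> 1" using V by simp
  have g5: "V (T \<union> (P - T)) R \<le> 1"
    using V_all_known_le[of R] RT TP by (simp add: Un_absorb1)
  have g6: "(\<Prod>p\<in>W' - W. 1 - 1 / real p) \<le>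
      real (D T R) * prod real W / (real (D T R) * prod real W + 1)"
    if W: "W \<subseteq> W'" "W' \<subseteq> P - T" "\<not> V (T \<union> W) R \<le> 1" "V (T \<union> W') R \<le> 1" for W W'
  proof -
    define d where "d = real (D (T \<union> W) R)"
    define q where "q = (\<Prod>p\<in>W' - W. 1 - 1 / real p)"
    have "d > 0" using D_pos by (simp add: d_def)
    have "q \<ge> 0" unfolding q_def using W P_gt_1 by (intro prod_nonneg) force
    have "(\<Prod>p\<in>P. if p \<in> W' - W then 1 - 1 / real p else 1) * V (T \<union> W) R \<le> V (T \<union> W') R"
    proof (rule V_scale)
      fix p assume p: "p \<in> P"
      show "0 \<le> (if p \<in> W' - W then 1 - 1 / real p else 1) \<and>
        (if p \<in> W' - W then 1 - 1 / real p else 1) \<le> 1 \<and>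
        (if p \<in> W' - W then 1 - 1 / real p else 1) * weight (T \<union> W) R p \<le> weight (T \<union> W') R p"
      proof (cases "p \<in> W' - W")
        case True
        then have "p \<notin> T" "p \<notin> R" using W RT by auto
        then show ?thesis using True P_gt_1[OF p] p by (simp add: weight_unknown weight_known)
      next
        case False
        then have "weight (T \<union> W) R p = weight (T \<union> W') R p"
          using W by (auto simp: weight_def num_def den_def)
        then show ?thesis using False by auto
      qed
    qed
    then have "q * V (T \<union> W) R \<le> 1"
      using W by (subst (asm) prod_restrict_P) (auto simp: q_def)
    moreover have "q * (1 + 1 / d) \<le> q * V (T \<union> W) R"
      unfolding d_def using W \<open>q \<ge> 0\<close> by (intro mult_left_mono V_ge_if_greater) auto
    ultimately have "q * (1 + 1 / d) \<le> 1" by linarith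
    then have "q \<le> d / (d + 1)" using \<open>d > 0\<close> by (simp add: field_simps)
    then show ?thesis using Dreal[of W] W by (simp add: q_def d_def)
  qed
  show thesis
  proof (rule greedy_subset[where X = "P - T" and a = "real (D T R)" and f = real and stop = "\<lambda>W. V (T \<union> W) R \<le> 1"])
    fix U
    assume U: "U \<subseteq> P - T" "U \<noteq> {}" "V (T \<union> U) R \<le> 1"
      and b: "real (D T R) * prod real U \<le> (real (D T R) + 1) ^ 2 ^ card U - (real (D T R) + 1) ^ 2 ^ (card U - 1)"
      and c: "\<And>W. W \<subseteq> U \<Longrightarrow> real (D T R) * prod real U + 1
        \<le> (real (D T R) * prod real W + 1) ^ 2 ^ (card U - card W)"
    show thesis by (rule that[OF U]) (use b c Dreal[OF U(1)] in auto)
  qed (fact g1 g2 g3 g4 g5 g6)+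
qed

text \<open>Before the crossing \<open>V\<close> is at most 1 - 1/d, afterwards at least 1, so the
  product of the 1 - 1/p^(e+1) is at most 1 - 1/d. Taking \<open>a = D T R - 1\<close> makes
  \<open>a + 1\<close> the old denominator; the greedy condition then needs d to be at most
  \<open>a * prod y W + 1\<close>.\<close>

lemma resolve_primes:
  assumes RT: "R \<subseteq> T" and TP: "T \<subseteq> P" and V: "V T R < 1"
  obtains W where "W \<subseteq> T - R" "W \<noteq> {}" "V T (R \<union> W) \<ge> 1"
    "(real (D T R) - 1) * (\<Prod>p\<in>W. real p ^ Suc (e p)) \<le>
      real (D T R) ^ 2 ^ card W - real (D T R) ^ 2 ^ (card W - 1)"
    "real (D T (R \<union> W)) + 1 \<le> real (D T R) ^ 2 ^ card W"
proof -
  define y where "y = (\<lambda>p. real p ^ Suc (e p))"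
  define a where "a = real (D T R) - 1"
  have y1: "y p > 1" if "p \<in> P" for p using power_gt_1[OF that] by (simp add: y_def)
  \<comment> \<open>A denominator 1 would give \<open>V\<close> at most 0.\<close>
  have "D T R \<noteq> 1" using V_le_if_less[OF V] V_pos[of T R] by auto
  then have D2: "D T R \<ge> 2" using D_pos[of T R] by linarith
  then have "a > 0" by (simp add: a_def)
  have resolved: "real (D T (R \<union> W)) - 1 \<le> a * prod y W" if W: "W \<subseteq> T - R" for W
  proof (cases "W = {}")
    case True
    then show ?thesis by (simp add: a_def)
  next
    case False
    have WP: "W \<subseteq> P" using W TP by blast
    then have finW: "finite W" by (rule finite_subset_P)
    obtain q where q: "q \<in> W" using False by blast
    \<comment> \<open>Since each p(p - 1) is at least 2, the new denominator is at most half of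
      \<open>D T R * prod y W\<close>. This factor 2 makes up for replacing \<open>D T R\<close> by
      \<open>a\<close>, which is at least half of it.\<close>
    have le: "2 * (\<Prod>p\<in>W. y p - 1) \<le> (\<Prod>p\<in>W. real p * (real p - 1)) * prod y W"
    proof -
      have "2 \<le> real p * (real p - 1)" if "p \<in> W" for p
      proof -
        have "2 \<le> real p" using P_gt_1[of p] that WP by auto
        then have "2 * 1 \<le> real p * (real p - 1)" by (intro mult_mono) auto
        then show ?thesis by simp
      qed
      note two = this
      have "2 * 1 \<le> real q * (real q - 1) * (\<Prod>p\<in>W - {q}. real p * (real p - 1))"
        using two[OF q] two by (intro mult_mono prod_ge_1) (auto intro: order_trans[of 1 2])
      then have "2 \<le> (\<Prod>p\<in>W. real p * (real p - 1))" using q finW by (simp add: prod.remove)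
      moreover have "(\<Prod>p\<in>W. y p - 1) \<le> prod y W" "0 \<le> (\<Prod>p\<in>W. y p - 1)"
        using less_imp_le[OF y1[OF subsetD[OF WP]]] by (auto intro!: prod_mono prod_nonneg)
      ultimately show ?thesis by (intro mult_mono) auto
    qed
    define c where "c = (\<Prod>p\<in>W. real p * (real p - 1))"
    have "c > 0" unfolding c_def using P_gt_1 WP by (intro prod_pos mult_pos_pos) force+
    have "c * (2 * real (D T (R \<union> W))) = real (D T R) * (2 * (\<Prod>p\<in>W. y p - 1))"
      using D_resolve[OF W TP] by (simp add: c_def y_def mult_ac)
    also have "\<dots> \<le> real (D T R) * (c * prod y W)"
      using le unfolding c_def by (intro mult_left_mono) auto
    also have "\<dots> = c * (real (D T R) * prod y W)" by simp
    finally have "2 * real (D T (R \<union> W)) \<le> real (D T R) * prod y W" using \<open>c > 0\<close> by simp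
    also have "\<dots> \<le> 2 * a * prod y W"
      unfolding a_def using D2 y1 WP by (intro mult_right_mono prod_nonneg) (auto intro: order_trans[OF zero_le_one less_imp_le])
    finally have "2 * real (D T (R \<union> W)) \<le> 2 * (a * prod y W)" by (simp only: mult.assoc)
    then show ?thesis by linarith
  qed
  have g1: "finite (T - R)" using TP finite_subset finite_P by blast
  have g2: "a > 0" by fact
  have g3: "y p > 1" if "p \<in> T - R" for p using y1 TP that by auto
  have g4: "\<not> V T (R \<union> {}) \<ge> 1" using V by simp
  have g5: "V T (R \<union> (T - R)) \<ge> 1"
    using V_unknown_greater[of T] V_all[of T] RT TP
    by (cases "T = P") (auto simp: Un_absorb1 psubset_eq intro: less_imp_le)
  have g6: "(\<Prod>p\<in>W' - W. 1 - 1 / y p) \<le> a * prod y W / (a * prod y W + 1)"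
    if W: "W \<subseteq> W'" "W' \<subseteq> T - R" "\<not> V T (R \<union> W) \<ge> 1" "V T (R \<union> W') \<ge> 1" for W W'
  proof -
    define d where "d = real (D T (R \<union> W))"
    define q where "q = (\<Prod>p\<in>W' - W. 1 - 1 / y p)"
    have "d > 0" using D_pos by (simp add: d_def)
    have y01: "0 \<le> 1 - 1 / y p" "1 - 1 / y p \<le> 1" if "p \<in> P" for p using y1[OF that] by auto
    have "q \<ge> 0" unfolding q_def using y01 W TP by (intro prod_nonneg) auto
    have "(\<Prod>p\<in>P. if p \<in> W' - W then 1 - 1 / y p else 1) * V T (R \<union> W') \<le> V T (R \<union> W)"
    proof (rule V_scale)
      fix p assume p: "p \<in> P"
      show "0 \<le> (if p \<in> W' - W then 1 - 1 / y p else 1) \<and>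
        (if p \<in> W' - W then 1 - 1 / y p else 1) \<le> 1 \<and>
        (if p \<in> W' - W then 1 - 1 / y p else 1) * weight T (R \<union> W') p \<le> weight T (R \<union> W) p"
      proof (cases "p \<in> W' - W")
        case True
        then have "weight T (R \<union> W) p = (1 - 1 / y p) * weight T (R \<union> W') p"
          unfolding y_def using W p by (intro weight_known_eq) auto
        then show ?thesis using True y01[OF p] by auto
      next
        case False
        then have "weight T (R \<union> W) p = weight T (R \<union> W') p"
          using W by (auto simp: weight_def num_def den_def)
        then show ?thesis using False by auto
      qed
    qed
    then have "q * V T (R \<union> W') \<le> V T (R \<union> W)"
      using W TP by (subst (asm) prod_restrict_P) (auto simp: q_def)
    moreover have "q * 1 \<le> q * V T (R \<union> W')"
      using W \<open>q \<ge> 0\<close> by (intro mult_left_mono) auto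
    moreover have "V T (R \<union> W) \<le> 1 - 1 / d"
      unfolding d_def using W by (intro V_le_if_less) auto
    ultimately have q: "q \<le> 1 - 1 / d" by linarith
    have "d \<le> a * prod y W + 1" using resolved[OF order_trans[OF W(1,2)]] by (simp add: d_def)
    note q
    also have "1 - 1 / d \<le> 1 - 1 / (a * prod y W + 1)"
      using \<open>d > 0\<close> \<open>d \<le> a * prod y W + 1\<close> by (intro diff_left_mono divide_left_mono mult_pos_pos) auto
    also have "\<dots> = a * prod y W / (a * prod y W + 1)"
      using \<open>d > 0\<close> \<open>d \<le> a * prod y W + 1\<close> by (simp add: field_simps)
    finally show ?thesis by (simp add: q_def)
  qed
  show thesis
  proof (rule greedy_subset[where X = "T - R" and a = "a" and f = y and stop = "\<lambda>W. V T (R \<union> W) \<ge> 1"])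
    fix W
    assume W: "W \<subseteq> T - R" "W \<noteq> {}" "1 \<le> V T (R \<union> W)"
      and b: "a * prod y W \<le> (a + 1) ^ 2 ^ card W - (a + 1) ^ 2 ^ (card W - 1)"
    have "real (D T R) ^ 1 \<le> real (D T R) ^ 2 ^ (card W - 1)"
      using D2 by (intro power_increasing) auto
    then have "(2::real) \<le> real (D T R) ^ 2 ^ (card W - 1)"
      using of_nat_mono[OF D2, where ?'a = real] by (simp only: power_one_right of_nat_numeral)
    then have "real (D T (R \<union> W)) + 1 \<le> real (D T R) ^ 2 ^ card W"
      using resolved[OF W(1)] b by (simp add: a_def)
    then show thesis using that[OF W] b by (simp add: y_def a_def)
  qed (fact g1 g2 g3 g4 g5 g6)+
qed

text \<open>Every prime becomes known once and resolved once, and each such event costs one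
  squaring. The exponent counts the events left after \<open>T\<close> and \<open>R\<close>, and the
  induction runs over whole cycles.\<close>

lemma D_final_le:
  assumes "R \<subseteq> T" "T \<subseteq> P" "V T R \<ge> 1"
  shows "real (D P P) + 1 \<le> (real (D T R) + 1) ^ 2 ^ (2 * card P - card T - card R)"
  using assms
proof (induction "2 * card P - card T - card R" arbitrary: T R rule: less_induct)
  case less
  note RT = less.prems(1) and TP = less.prems(2)
  have finT: "finite T" and finR: "finite R" using RT TP finite_subset_P by auto
  show ?case
  proof (cases "V T R = 1")
    case True
    then have "R = P" "T = P" using V_eq_1D[OF RT TP] RT TP by auto
    then show ?thesis by simp
  next
    case False
    then have "V T R > 1" using less.prems by simp
    then obtain U where U: "U \<subseteq> P - T" "U \<noteq> {}" "V (T \<union> U) R \<le> 1"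
      "\<And>W. W \<subseteq> U \<Longrightarrow>
        real (D (T \<union> U) R) + 1 \<le> (real (D T R) * real (\<Prod>W) + 1) ^ 2 ^ (card U - card W)"
      using add_primes[OF RT TP] by metis
    have TU: "R \<subseteq> T \<union> U" "T \<union> U \<subseteq> P" using U RT TP by auto
    \<comment> \<open>Value 1 would mean \<open>R = P\<close>, but then \<open>V T R\<close> would
      be 1 already.\<close>
    have "V (T \<union> U) R \<noteq> 1"
      using V_eq_1D[OF TU] V_all \<open>V T R > 1\<close> by fastforce
    then have "V (T \<union> U) R < 1" using U by simp
    then obtain W where W: "W \<subseteq> T \<union> U - R" "W \<noteq> {}" "V (T \<union> U) (R \<union> W) \<ge> 1"
      "real (D (T \<union> U) (R \<union> W)) + 1 \<le> real (D (T \<union> U) R) ^ 2 ^ card W"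
      using resolve_primes[OF TU] by metis
    have finU: "finite U" and finW: "finite W"
      using finite_subset_P[of U] finite_subset_P[of W] U(1) W(1) TU(2) by blast+
    have cards: "card (T \<union> U) = card T + card U" "card (R \<union> W) = card R + card W"
      using U W finT finR finU finW by (auto intro!: card_Un_disjoint)
    have c0: "card U > 0" "card W > 0" using U W finU finW by (auto simp: card_gt_0_iff)
    define n where "n = 2 * card P - card (T \<union> U) - card (R \<union> W)"
    have RW: "R \<union> W \<subseteq> T \<union> U" using W TU by auto
    have "card (T \<union> U) \<le> card P" "card (R \<union> W) \<le> card P"
      using card_subset_P TU(2) order_trans[OF RW TU(2)] by auto
    then have n: "2 * card P - card T - card R = card U + card W + n"
      using cards by (simp add: n_def)
    then have "n < 2 * card P - card T - card R" using c0 by simp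
    then have "real (D P P) + 1 \<le> (real (D (T \<union> U) (R \<union> W)) + 1) ^ 2 ^ n"
      using less.hyps[OF _ RW TU(2) W(3)] unfolding n_def by simp
    also have "\<dots> \<le> (real (D (T \<union> U) R) ^ 2 ^ card W) ^ 2 ^ n"
      using W by (intro power_mono) auto
    also have "\<dots> \<le> (((real (D T R) + 1) ^ 2 ^ card U) ^ 2 ^ card W) ^ 2 ^ n"
      using U(4)[of "{}"] by (intro power_mono) auto
    also have "\<dots> = (real (D T R) + 1) ^ 2 ^ (2 * card P - card T - card R)"
      unfolding n by (simp add: power_mult[symmetric] power_add mult_ac)
    finally show ?thesis .
  qed
qed

end

subsection \<open>The first cycle\<close>

text \<open>For the case where the first cycle already resolves everything: \<open>A\<close> is the
  product of the primes and \<open>N\<close> that of the prime powers, so \<open>N * A\<close> is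
  the product of the p^(e+1).\<close>

lemma resolved_all_bound:
  fixes A N :: real
  assumes "K > 0" "A \<ge> 2" and A: "A \<le> 2 ^ 2 ^ K - 2 ^ 2 ^ (K - 1)"
    and N: "(A - 1) * (N * A) \<le> A ^ 2 ^ K - A ^ 2 ^ (K - 1)"
  shows "N \<le> 2 ^ (4 ^ K - 2 * 2 ^ K)"
proof (cases "K = 1")
  case True
  then have "A = 2" using assms by simp
  then show ?thesis using N True by simp
next
  case False
  then obtain k where K: "K = Suc (Suc k)" using \<open>K > 0\<close> by (cases K; cases "K - 1") auto
  define h where "h = (2::real) ^ 2 ^ (K - 1)"
  \<comment> \<open>Of the \<open>n + 3\<close> factors \<open>A\<close>, one cancels, two are
    traded for \<open>(A - 1) * (h * h)\<close>, and the other \<open>n\<close> are bounded by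
    \<open>h * h\<close>.\<close>
  define n where "n = (2::nat) ^ K - 3"
  have "(2::nat) ^ 2 \<le> 2 ^ K" unfolding K by (intro power_increasing) auto
  then have n: "2 ^ K = n + 3" by (simp add: n_def)
  have hh: "2 ^ 2 ^ K = h * h" by (simp add: h_def K mult_2 power_add)
  have "(2::real) ^ 1 \<le> h" unfolding h_def by (intro power_increasing) auto
  then have h: "h \<ge> 2" by simp
  have Ah: "A \<le> h * h - h" using A by (simp add: hh h_def)
  \<comment> \<open>If \<open>A\<close> is at least \<open>h\<close>, both factors on the right are
    at least \<open>h\<close>. Otherwise the first is at least 2 and the second at least half of
    \<open>h * h\<close>.\<close>
  have "h * h \<le> A * (h * h - A)"
  proof (cases "h \<le> A")
    case True
    then show ?thesis using Ah h by (intro mult_mono) auto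
  next
    case False
    have "2 * h \<le> h * h" using h by (intro mult_right_mono) auto
    then have "2 * (h * h - h) \<ge> h * h" by (simp add: algebra_simps)
    moreover have "2 * (h * h - h) \<le> A * (h * h - A)"
      using assms(2) False h \<open>2 * h \<le> h * h\<close> by (intro mult_mono) auto
    ultimately show ?thesis by linarith
  qed
  then have AA: "A * A \<le> (A - 1) * (h * h)" by (simp add: algebra_simps)
  have "0 \<le> A ^ 2 ^ (K - 1)" using assms by simp
  then have "((A - 1) * N) * A \<le> A ^ (n + 3)" using N n by (simp add: mult_ac)
  also have "\<dots> = (A ^ n * (A * A)) * A" by (simp add: power_add power3_eq_cube mult_ac)
  finally have "(A - 1) * N \<le> A ^ n * (A * A)" using assms by simp
  also have "\<dots> \<le> (h * h) ^ n * ((A - 1) * (h * h))"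
  proof (rule mult_mono)
    show "A ^ n \<le> (h * h) ^ n" using Ah h assms by (intro power_mono) auto
  qed (use AA in auto)
  also have "\<dots> = (A - 1) * (h * h) ^ (n + 1)" by simp
  finally have "N \<le> (h * h) ^ (n + 1)" using assms by simp
  also have "\<dots> = 2 ^ ((n + 3) * (n + 1))" unfolding hh[symmetric] n by (rule power_mult[symmetric])
  also have "(n + 3) * (n + 1) = 4 ^ K - 2 * 2 ^ K"
  proof -
    have "(4::nat) ^ K = 2 ^ K * 2 ^ K" by (simp flip: power_mult_distrib)
    then show ?thesis by (simp add: n algebra_simps)
  qed
  finally show ?thesis .
qed

text \<open>Here \<open>A\<close> and \<open>d\<close> are the denominators after the two halves,
  \<open>c\<close> is the product of the \<open>s\<close> resolved primes and \<open>F\<close> that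
  of their p^(e+1). The saving \<open>2 ^ s\<close> in the exponent comes from dividing by
  \<open>c\<close>: a large \<open>c\<close> is divided out directly, while a small \<open>c\<close>
  makes \<open>A\<close> itself small through \<open>Ac\<close>.\<close>

lemma first_cycle_bound:
  fixes A d F c :: real
  assumes "s > 0" "s \<le> r" "d \<ge> 0" "c \<ge> 2" "c \<le> A"
    and A4: "s \<ge> 2 \<Longrightarrow> A \<ge> 4"
    and d: "2 * (d * c) \<le> A * F"
    and F: "(A - 1) * F \<le> A ^ 2 ^ s - A ^ 2 ^ (s - 1)"
    and Ac: "A + 1 \<le> (c + 1) ^ 2 ^ (r - s)"
    and A: "A \<le> 2 ^ 2 ^ r"
    and c: "c + 1 \<le> 2 ^ 2 ^ s \<or> 2 ^ 2 ^ s \<le> c"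
  shows "d + 1 \<le> 2 ^ (2 ^ (r + s) - 2 ^ s)"
proof -
  define m where "m = (2::nat) ^ s"
  define n where "n = (2::nat) ^ r - 1"
  have n: "2 ^ r = Suc n" by (simp add: n_def)
  have "(2::nat) ^ 1 \<le> 2 ^ r" "(2::nat) ^ 1 \<le> m"
    unfolding m_def using assms by (intro power_increasing; simp)+
  then have "n \<ge> 1" "m \<ge> 2" using n by auto
  have "2 ^ (r + s) = m * Suc n" unfolding m_def n[symmetric] by (simp add: power_add)
  then have exponent: "2 ^ (r + s) - 2 ^ s = m * n" by (simp add: m_def)
  have A2: "A \<ge> 2" using assms by linarith
  \<comment> \<open>For \<open>s = 1\<close> the subtracted power cancels the factor
    \<open>A - 1\<close> exactly; otherwise \<open>A\<close> is at least 4 and A / (A - 1) at most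
    4/3.\<close>
  have AF: "3 * (A * F) \<le> 4 * A ^ m"
  proof (cases "s = 1")
    case True
    then have "(A - 1) * F \<le> (A - 1) * A" using F by (simp add: power2_eq_square algebra_simps)
    then have "F \<le> A" using A2 by simp
    then have "A * F \<le> A * A" using A2 by (intro mult_left_mono) auto
    moreover have "0 \<le> A * A" using A2 by simp
    moreover have "A ^ m = A * A" using True by (simp add: m_def power2_eq_square)
    ultimately show ?thesis by linarith
  next
    case False
    then have "A \<ge> 4" using A4 assms by linarith
    have "0 \<le> A ^ 2 ^ (s - 1)" using A2 by simp
    then have *: "(A - 1) * F \<le> A ^ m" using F by (simp add: m_def)
    show ?thesis
    proof (cases "F \<ge> 0")
      case True
      then have "(3 * A) * F \<le> (4 * (A - 1)) * F" using \<open>A \<ge> 4\<close> by (intro mult_right_mono) auto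
      then have "3 * (A * F) \<le> 4 * ((A - 1) * F)" by (simp only: mult.assoc)
      then show ?thesis using * by linarith
    next
      case False
      then have "A * F \<le> 0" using A2 by (simp add: mult_nonneg_nonpos)
      moreover have "0 \<le> A ^ m" using A2 by simp
      ultimately show ?thesis by linarith
    qed
  qed
  then have dc: "3 * (d * c) \<le> 2 * A ^ m" using d by linarith
  have "d + 1 \<le> (2 ^ m) ^ n"
    using c
  proof
    assume c': "c + 1 \<le> 2 ^ 2 ^ s"
    \<comment> \<open>As \<open>c\<close> is at least 2, \<open>d\<close> is at most half of
      \<open>d * c\<close>; the resulting 3/2 is matched by the constants in
      \<open>dc\<close>.\<close>
    have "(c + 1) * (d + 1) \<le> 3 / 2 * (d * c) + (A + 1)"
      using mult_right_mono[OF \<open>c \<ge> 2\<close> \<open>d \<ge> 0\<close>] \<open>c \<le> A\<close> by (simp add: algebra_simps)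
    also have "\<dots> \<le> A ^ m + (A + 1)" using dc by linarith
    also have "\<dots> \<le> (A + 1) ^ m"
    proof -
      obtain l where l: "m = Suc (Suc l)" using \<open>m \<ge> 2\<close> by (metis Suc_le_D numeral_2_eq_2 Suc_le_mono)
      have "A ^ Suc l \<le> (A + 1) ^ Suc l" using A2 by (intro power_mono) auto
      then have "A * A ^ Suc l \<le> A * (A + 1) ^ Suc l" using A2 by (intro mult_left_mono) auto
      moreover have "(A + 1) ^ 1 \<le> (A + 1) ^ Suc l" using A2 by (intro power_increasing) auto
      ultimately show ?thesis by (simp add: l algebra_simps)
    qed
    also have "\<dots> \<le> ((c + 1) ^ 2 ^ (r - s)) ^ m"
      using Ac A2 by (intro power_mono) auto
    also have "\<dots> = (c + 1) ^ Suc n"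
      using \<open>s \<le> r\<close> by (simp add: m_def power_mult[symmetric] power_add[symmetric] n[symmetric] del: power_Suc)
    finally have "d + 1 \<le> (c + 1) ^ n" using \<open>c \<ge> 2\<close> by simp
    also have "\<dots> \<le> (2 ^ m) ^ n" using c' \<open>c \<ge> 2\<close> unfolding m_def by (intro power_mono) auto
    finally show ?thesis .
  next
    assume c': "2 ^ 2 ^ s \<le> c"
    have "3 * d * 2 ^ m \<le> 3 * d * c" using c' \<open>d \<ge> 0\<close> unfolding m_def by (intro mult_left_mono) auto
    also have "\<dots> \<le> 2 * A ^ m" using dc by simp
    also have "A ^ m \<le> (2 ^ Suc n) ^ m"
      using A A2 unfolding n by (intro power_mono) auto
    also have "(2::real) ^ Suc n = 2 ^ n * 2" by simp
    also have "(2 ^ n * 2 :: real) ^ m = (2 ^ m) ^ n * 2 ^ m"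
      by (simp add: power_mult_distrib power_mult[symmetric] mult.commute)
    finally have "3 * d \<le> 2 * (2 ^ m) ^ n" by simp
    \<comment> \<open>The third of the power left over in the bound for \<open>d\<close> exceeds 1
      and absorbs the \<open>+ 1\<close>.\<close>
    moreover have "(2::real) ^ 2 \<le> 2 ^ (m * n)"
      using \<open>m \<ge> 2\<close> \<open>n \<ge> 1\<close> by (intro power_increasing) (auto intro: order_trans[OF _ mult_le_mono[of 2 m 1 n]])
    ultimately show ?thesis by (simp add: power_mult)
  qed
  then show ?thesis by (simp add: exponent power_mult)
qed

text \<open>For \<open>W = {2}\<close> the product of the p - 1 is 1, so the factor 2 assumed in
  \<open>first_cycle_bound\<close> is missing. Here \<open>c = 2\<close> is explicit instead, and
  the base 3^2 = 9 stays far enough below 16.\<close>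

lemma first_cycle_bound_two:
  fixes A d :: real
  assumes "A \<ge> 4" "2 * d \<le> A * (A - 1)" "A + 1 \<le> 3 ^ 2 ^ (r - 1)"
  shows "d + 1 \<le> 2 ^ (2 ^ (r + 1) - 2 ^ 1)"
proof -
  \<comment> \<open>For smaller \<open>r\<close> the last assumption would read
    \<open>A + 1 \<le> 3\<close>.\<close>
  have "r \<ge> 2"
  proof (rule ccontr)
    assume "\<not> r \<ge> 2"
    then have "r - 1 = 0" by simp
    then show False using assms by simp
  qed
  define n where "n = (2::nat) ^ (r - 1)"
  have "(2::nat) ^ 1 \<le> n" unfolding n_def using \<open>r \<ge> 2\<close> by (intro power_increasing) auto
  then have "n \<ge> 2" by simp
  have "2 * (d + 1) \<le> A * A" using assms(1,2) by (simp add: algebra_simps)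
  also have "\<dots> \<le> 3 ^ n * 3 ^ n" using assms unfolding n_def by (intro mult_mono) auto
  also have "\<dots> = 9 ^ n" by (simp flip: power_mult_distrib)
  finally have "2 * (d + 1) \<le> 9 ^ n" .
  moreover have "2 * (9::real) ^ n \<le> 16 ^ n"
    using \<open>n \<ge> 2\<close>
  proof (induction n rule: dec_induct)
    case (step n)
    have "(0::real) \<le> 16 ^ n" by simp
    then show ?case using step.IH unfolding power_Suc by linarith
  qed simp
  moreover have "2 ^ (r + 1) = 4 * n" using \<open>r \<ge> 2\<close> by (cases r) (auto simp: n_def)
  moreover have "(2::real) ^ (4 * n) = 16 ^ n" by (simp add: power_mult)
  moreover have "(2::real) ^ (4 * n) = 2 ^ (4 * n - 2) * 4"
  proof -
    have "4 * n = (4 * n - 2) + 2" using \<open>n \<ge> 2\<close> by simp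
    then have "(2::real) ^ (4 * n) = 2 ^ (4 * n - 2) * 2 ^ 2" by (metis power_add)
    then show ?thesis by simp
  qed
  ultimately show ?thesis by simp
qed

context amicable_factorization
begin

lemma first_cycle_P:
  assumes UP: "U \<subseteq> P" and WU: "W \<subseteq> U" "W \<noteq> {}"
    and known: "\<And>W. W \<subseteq> U \<Longrightarrow>
      real (D U {}) + 1 \<le> (real (\<Prod>W) + 1) ^ 2 ^ (card U - card W)"
    and resolved: "(real (D U {}) - 1) * (\<Prod>p\<in>W. real p ^ Suc (e p)) \<le>
      real (D U {}) ^ 2 ^ card W - real (D U {}) ^ 2 ^ (card W - 1)"
  shows "real (D U W) + 1 \<le> 2 ^ (2 ^ (card U + card W) - 2 ^ card W)"
proof -
  define A where "A = real (D U {})"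
  define F where "F = (\<Prod>p\<in>W. real p ^ Suc (e p))"
  define d where "d = real (D U W)"
  define c where "c = real (\<Prod>W)"
  have WP: "W \<subseteq> P" and finU: "finite U" and finW: "finite W"
    using UP WU finite_subset_P by auto
  have ge2: "real p \<ge> 2" if "p \<in> P" for p using P_gt_1[OF that] by simp
  have "D U {} = \<Prod>U" using D_add_known[of "{}" "{}" U] UP by (simp add: D_def den_def)
  then have AU: "A = prod real U" by (simp add: A_def)
  have cA: "c \<le> A"
    unfolding AU c_def of_nat_prod using WU finU UP ge2
    by (intro prod_mono2) (force intro: order_trans[of 1 2])+
  have c_pow: "2 ^ card W \<le> c"
    unfolding c_def of_nat_prod using prod_mono[of W "\<lambda>_. 2::real" real] ge2 WP by auto
  have "card W > 0" using WU finW by (auto simp: card_gt_0_iff)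
  have pow2: "(2::real) ^ k \<le> A" if "k \<le> card W" for k
    using power_increasing[OF that, of "2::real"] c_pow cA by linarith
  have dF: "d * (c * (\<Prod>p\<in>W. real p - 1)) \<le> A * F"
  proof -
    have "d * (\<Prod>p\<in>W. real p * (real p - 1)) = A * (\<Prod>p\<in>W. real p ^ Suc (e p) - 1)"
      using D_resolve[of W U "{}"] WU UP by (simp add: A_def d_def)
    also have "\<dots> \<le> A * F"
      unfolding F_def A_def using less_imp_le[OF power_gt_1[OF subsetD[OF WP]]]
      by (intro mult_left_mono prod_mono) auto
    finally show ?thesis by (simp add: c_def prod.distrib)
  qed
  have resolved': "(A - 1) * F \<le> A ^ 2 ^ card W - A ^ 2 ^ (card W - 1)"
    using resolved by (simp add: A_def F_def)
  show ?thesis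
  proof (cases "W = {2}")
    case True
    have "e 2 > 0" using True WP e_pos_P by auto
    then have "(2::real) ^ 2 \<le> 2 ^ Suc (e 2)" by (intro power_increasing) auto
    \<comment> \<open>Together with \<open>F \<le> A\<close> below, this supplies
      \<open>A \<ge> 4\<close>.\<close>
    then have F4: "F \<ge> 4" using True by (simp add: F_def)
    have "A \<ge> 2" using pow2[of 1] True by simp
    moreover have "(A - 1) * F \<le> (A - 1) * A"
      using resolved' True by (simp add: power2_eq_square algebra_simps)
    ultimately have "F \<le> A" by simp
    have "d * 2 = A * (F - 1)"
      using D_resolve[of W U "{}"] WU UP True by (simp add: A_def d_def F_def)
    also have "\<dots> \<le> A * (A - 1)" using \<open>F \<le> A\<close> \<open>A \<ge> 2\<close> by (intro mult_left_mono) auto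
    finally have "d + 1 \<le> 2 ^ (2 ^ (card U + 1) - 2 ^ 1)"
      using known[of W] True WU F4 \<open>F \<le> A\<close>
      by (intro first_cycle_bound_two[of A]) (auto simp: A_def)
    then show ?thesis using True by (simp add: d_def)
  next
    case False
    then obtain q where q: "q \<in> W" "q \<noteq> 2" using WU by blast
    then have "q > 2" using P_gt_1[of q] WP by auto
    \<comment> \<open>An odd prime in \<open>W\<close> makes the product of the p - 1 at least 2,
      the factor 2 required by \<open>first_cycle_bound\<close>.\<close>
    have "2 * 1 \<le> (real q - 1) * (\<Prod>p\<in>W - {q}. real p - 1)"
      using \<open>q > 2\<close> ge2 WP by (intro mult_mono prod_ge_1) force+
    then have q2: "2 \<le> (\<Prod>p\<in>W. real p - 1)" using q finW by (simp add: prod.remove)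
    have "d \<ge> 0" by (simp add: d_def)
    have c2: "c \<ge> 2"
      using power_increasing[of 1 "card W" "2::real"] c_pow \<open>card W > 0\<close> by simp
    have "d * c * 2 \<le> d * c * (\<Prod>p\<in>W. real p - 1)"
      using q2 \<open>d \<ge> 0\<close> c2 by (intro mult_left_mono) auto
    then have d2: "2 * (d * c) \<le> A * F" using dF by (simp add: mult_ac)
    have "A + 1 \<le> 2 ^ 2 ^ card U" using known[of "{}"] by (simp add: A_def)
    then have A2: "A \<le> 2 ^ 2 ^ card U" by simp
    \<comment> \<open>The dichotomy relies on integrality: a natural number below the power is below
      it by at least 1.\<close>
    have "real (\<Prod>W + 1) \<le> real (2 ^ 2 ^ card W) \<or> real (2 ^ 2 ^ card W) \<le> real (\<Prod>W)"
      unfolding of_nat_le_iff by linarith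
    then have cc: "c + 1 \<le> 2 ^ 2 ^ card W \<or> 2 ^ 2 ^ card W \<le> c"
      unfolding c_def by (simp only: of_nat_1 of_nat_add of_nat_numeral of_nat_power)
    have "d + 1 \<le> 2 ^ (2 ^ (card U + card W) - 2 ^ card W)"
      by (rule first_cycle_bound[of _ _ d c A F])
        (use \<open>card W > 0\<close> card_mono[OF finU WU(1)] \<open>d \<ge> 0\<close> c2 cA pow2[of 2] d2 resolved'
           known[OF WU(1)] A2 cc in \<open>auto simp: A_def c_def\<close>)
    then show ?thesis by (simp add: d_def)
  qed
qed

text \<open>If the first cycle makes all primes known, it must resolve them all and
  \<open>resolved_all_bound\<close> applies. Otherwise its sharpened bound is fed into
  \<open>D_final_le\<close>.\<close>

lemma prod_powers_le: "real (\<Prod>p\<in>P. p ^ e p) \<le> 2 ^ (4 ^ card P - 2 * 2 ^ card P)"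
proof -
  have D0: "D {} {} = 1" by (simp add: D_def den_def)
  have "V {} {} = real (card I)" by (simp add: V_def weight_unknown)
  then have "V {} {} > 1" using card_I by simp
  then obtain U where U: "U \<subseteq> P" "U \<noteq> {}" "V U {} \<le> 1"
    "real (D U {}) \<le> 2 ^ 2 ^ card U - 2 ^ 2 ^ (card U - 1)"
    "\<And>W. W \<subseteq> U \<Longrightarrow>
      real (D U {}) + 1 \<le> (real (\<Prod>W) + 1) ^ 2 ^ (card U - card W)"
    using add_primes[of "{}" "{}"] D0 by auto
  have "V U {} \<noteq> 1" using V_eq_1D[of "{}" U] U by blast
  then have "V U {} < 1" using U by simp
  obtain W where "W \<subseteq> U - {}" and W': "W \<noteq> {}" "V U ({} \<union> W) \<ge> 1"
    "(real (D U {}) - 1) * (\<Prod>p\<in>W. real p ^ Suc (e p)) \<le>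
      real (D U {}) ^ 2 ^ card W - real (D U {}) ^ 2 ^ (card W - 1)"
    by (rule resolve_primes[OF empty_subsetI U(1) \<open>V U {} < 1\<close>])
  then have W: "W \<subseteq> U" "W \<noteq> {}" "V U W \<ge> 1"
    by auto
  have finU: "finite U" using finite_subset_P U by blast
  show ?thesis
  proof (cases "U = P")
    case True
    then have "W = P" using V_all_known_less[of W] W by (metis not_le psubsetI)
    have A: "real (D P {}) = prod real P"
      using D_add_known[of "{}" "{}" P] by (simp add: D_def den_def)
    have ge2: "real p \<ge> 2" if "p \<in> P" for p using P_gt_1[OF that] by simp
    have K: "card P > 0" using U True by (auto simp: card_gt_0_iff)
    have "(2::real) ^ 1 \<le> 2 ^ card P" using K by (intro power_increasing) auto
    also have "\<dots> \<le> prod real P" using prod_mono[of P "\<lambda>_. 2::real" real] ge2 by auto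
    finally have "prod real P \<ge> 2" by simp
    moreover have "(\<Prod>p\<in>P. real p ^ Suc (e p)) = real (\<Prod>p\<in>P. p ^ e p) * prod real P"
      by (simp add: prod.distrib mult.commute)
    ultimately show ?thesis
      using resolved_all_bound[OF K, of "prod real P"] U(4) W'(3) True \<open>W = P\<close> A by simp
  next
    case False
    define r where "r = card U"
    define s where "s = card W"
    define t where "t = 2 * card P - r - s"
    have "r < card P" unfolding r_def using U False by (intro psubset_card_mono) auto
    have "s \<le> r" unfolding r_def s_def using W finU by (intro card_mono) auto
    have t: "2 * card P = (r + s) + t" using \<open>r < card P\<close> \<open>s \<le> r\<close> by (simp add: t_def)
    have "real (\<Prod>p\<in>P. p ^ e p) \<le> real (D P P)"
      unfolding D_def of_nat_le_iff den_def
      using less_imp_le[OF geometric_sum_gt[OF P_gt_1 e_pos_P]] by (intro prod_mono) auto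
    also have "\<dots> \<le> real (D P P) + 1" by simp
    also have "\<dots> \<le> (real (D U W) + 1) ^ 2 ^ t"
      using D_final_le[OF W(1) U(1) W(3)] by (simp add: t_def r_def s_def)
    also have "\<dots> \<le> (2 ^ (2 ^ (r + s) - 2 ^ s)) ^ 2 ^ t"
      unfolding r_def s_def
      using first_cycle_P[OF U(1) W(1,2) U(5) W'(3)] by (intro power_mono) auto
    also have "\<dots> = 2 ^ (2 ^ (2 * card P) - 2 ^ (s + t))"
      unfolding t by (simp add: power_mult[symmetric] power_add diff_mult_distrib2 mult_ac)
    also have "\<dots> \<le> 2 ^ (4 ^ card P - 2 * 2 ^ card P)"
    proof (intro power_increasing)
      \<comment> \<open>Since \<open>r < card P\<close>, the number \<open>s + t\<close> of
        remaining squarings plus resolved primes is at least \<open>card P + 1\<close>; this yields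
        the saving \<open>2 * 2 ^ card P\<close>.\<close>
      have "(2::nat) ^ Suc (card P) \<le> 2 ^ (s + t)"
        using t \<open>r < card P\<close> by (intro power_increasing) auto
      then show "2 ^ (2 * card P) - 2 ^ (s + t) \<le> (4::nat) ^ card P - 2 * 2 ^ card P"
        by (simp add: power_mult)
    qed simp
    finally show ?thesis .
  qed
qed

end

subsection \<open>Sums of divisors\<close>

lemma divisor_sigma_coprime_mult:
  assumes "coprime a b" "a > 0" "b > 0"
  shows "divisor_sigma (a * b) = divisor_sigma a * divisor_sigma b"
proof -
  have inj: "inj_on (\<lambda>(x, y). x * y) ({d. d dvd a} \<times> {d. d dvd b})"
  proof (rule inj_onI, clarsimp)
    fix x y x' y' assume *: "x dvd a" "y dvd b" "x' dvd a" "y' dvd b" "x * y = x' * y'"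
    have "coprime x y'" "coprime x' y" "coprime y x'" "coprime y' x"
      using * assms(1) by (meson coprime_commute coprime_divisors)+
    then have "x dvd x'" "x' dvd x" "y dvd y'" "y' dvd y"
      using *(5) by (metis coprime_dvd_mult_left_iff coprime_dvd_mult_right_iff dvd_triv_left dvd_triv_right)+
    then show "x = x' \<and> y = y'" by (simp add: dvd_antisym)
  qed
  have img: "{d. d dvd a * b} = (\<lambda>(x, y). x * y) ` ({d. d dvd a} \<times> {d. d dvd b})"
    using division_decomp[of _ a b] by (fastforce intro: mult_dvd_mono)
  have "divisor_sigma (a * b) = (\<Sum>(x, y)\<in>{d. d dvd a} \<times> {d. d dvd b}. x * y)"
    unfolding divisor_sigma_def img by (subst sum.reindex[OF inj]) (auto intro: sum.cong)
  then show ?thesis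
    by (simp add: divisor_sigma_def sum_product sum.cartesian_product)
qed

lemma divisor_sigma_prime_power:
  assumes "prime p"
  shows "divisor_sigma (p ^ n) = geometric_sum p n"
proof -
  have "{d. d dvd p ^ n} = (\<lambda>j. p ^ j) ` {..n}"
    using divides_primepow_nat[OF assms] by auto
  moreover have "inj_on (\<lambda>j. p ^ j) {..n}"
    using prime_gt_1_nat[OF assms] by (auto simp: inj_on_def)
  ultimately show ?thesis
    by (simp add: divisor_sigma_def geometric_sum_def sum.reindex)
qed

lemma divisor_sigma_prod_prime_powers:
  assumes "finite S" "\<And>p. p \<in> S \<Longrightarrow> prime p"
  shows "divisor_sigma (\<Prod>p\<in>S. p ^ f p) = (\<Prod>p\<in>S. geometric_sum p (f p))"
  using assms
proof (induction S rule: finite_induct)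
  case empty
  then show ?case by (simp add: divisor_sigma_def)
next
  case (insert q S)
  have "coprime (q ^ f q) (\<Prod>p\<in>S. p ^ f p)"
  proof (intro prod_coprime_right coprime_power_left_iff[THEN iffD2] disjI1 coprime_power_right_iff[THEN iffD2])
    show "coprime q p" if "p \<in> S" for p
      using insert that by (intro primes_coprime) auto
  qed
  moreover have "q ^ f q > 0" "(\<Prod>p\<in>S. p ^ f p) > 0"
    using insert.prems by (auto intro!: prod_pos simp: prime_gt_0_nat)
  ultimately show ?case
    using insert by (simp add: divisor_sigma_coprime_mult divisor_sigma_prime_power)
qed

section \<open>From the amicable tuple to the factorization\<close>

theorem theorem3:
  fixes k K :: nat and M :: "nat \<Rightarrow> nat"
  assumes "k \<ge> 2"
    and "amicable_tuple k M"
    and "\<And>i j. i \<in> {1..k} \<Longrightarrow> j \<in> {1..k} \<Longrightarrow> i \<noteq> j \<Longrightarrow> coprime (M i) (M j)"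
    and "gcd (\<Prod>i=1..k. M i) (\<Sum>i=1..k. M i) = 1"
    and "K = prime_omega (\<Prod>i=1..k. M i)"
  shows "real (\<Prod>i=1..k. M i) < pi ^ 2 / 6 * 2 powr (4 ^ K - 2 * 2 ^ K)"
proof -
  define N where "N = (\<Prod>i=1..k. M i)"
  define S where "S = (\<Sum>i=1..k. M i)"
  define A where "A = (\<lambda>i. prime_factors (M i))"
  \<comment> \<open>The exponent is taken in the whole product; by pairwise coprimality it agrees
    with the one in the entry that \<open>p\<close> divides.\<close>
  define e where "e = (\<lambda>p. multiplicity p N)"
  have Mpos: "M i > 0" and sigma: "divisor_sigma (M i) = S" if "i \<in> {1..k}" for i
    using assms(2) that by (auto simp: amicable_tuple_def S_def)
  have zero: "0 \<notin> M ` {1..k}" using Mpos by (metis imageE less_irrefl)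
  have Npos: "N > 0" using Mpos by (auto simp: N_def)
  have dvdN: "M i dvd N" if "i \<in> {1..k}" for i
    unfolding N_def using that by (intro dvd_prodI) auto
  have e_eq: "e p = multiplicity p (M i)" if "i \<in> {1..k}" "p \<in> A i" for i p
  proof -
    have p: "prime p" "p dvd M i" using that by (auto simp: A_def)
    have "multiplicity p (M j) = 0" if "j \<in> {1..k} - {i}" for j
    proof -
      have "coprime (M i) (M j)" using assms(3) that \<open>i \<in> {1..k}\<close> by auto
      then have "\<not> p dvd M j" using p coprime_common_divisor not_prime_unit by blast
      then show ?thesis by (rule not_dvd_imp_multiplicity_0)
    qed
    moreover have "e p = (\<Sum>j=1..k. multiplicity p (M j))"
      unfolding e_def N_def
      using p zero by (intro prime_elem_multiplicity_prod_distrib) auto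
    ultimately show ?thesis using that by (simp add: sum.remove[of _ i])
  qed
  have M_eq: "M i = (\<Prod>p\<in>A i. p ^ e p)" if "i \<in> {1..k}" for i
    using prime_factorization_nat[OF Mpos[OF that]] e_eq[OF that]
    by (simp add: A_def cong: prod.cong)
  have S_eq: "S = (\<Prod>p\<in>A i. geometric_sum p (e p))" if "i \<in> {1..k}" for i
  proof -
    have "divisor_sigma (\<Prod>p\<in>A i. p ^ e p) = (\<Prod>p\<in>A i. geometric_sum p (e p))"
      by (rule divisor_sigma_prod_prime_powers) (auto simp: A_def)
    then show ?thesis using sigma[OF that] by (simp only: M_eq[OF that, symmetric])
  qed
  have Spos: "S > 0" unfolding S_def using Mpos assms(1) by (intro sum_pos) auto
  have sum: "(\<Sum>i\<in>{1..k}. \<Prod>p\<in>A i. real (p ^ e p) / real (geometric_sum p (e p))) = 1"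
  proof -
    have "(\<Prod>p\<in>A i. real (p ^ e p) / real (geometric_sum p (e p))) = real (M i) / real S"
      if "i \<in> {1..k}" for i
      unfolding prod_dividef of_nat_prod[symmetric] using M_eq[OF that] S_eq[OF that] by simp
    then have "(\<Sum>i\<in>{1..k}. \<Prod>p\<in>A i. real (p ^ e p) / real (geometric_sum p (e p))) =
        (\<Sum>i\<in>{1..k}. real (M i) / real S)" by (intro sum.cong) auto
    also have "\<dots> = real S / real S" by (simp add: sum_divide_distrib[symmetric] S_def)
    finally show ?thesis using Spos by simp
  qed
  interpret amicable_factorization "{1..k}" A e
  proof
    show "A i \<inter> A j = {}" if "i \<in> {1..k}" "j \<in> {1..k}" "i \<noteq> j" for i j
    proof -
      have "p \<notin> A j" if "p \<in> A i" for p
        using that coprime_common_divisor[OF assms(3)[OF \<open>i \<in> {1..k}\<close> \<open>j \<in> {1..k}\<close> \<open>i \<noteq> j\<close>], of p]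
        by (auto simp: A_def in_prime_factors_iff)
      then show ?thesis by blast
    qed
    show "e p > 0" if "i \<in> {1..k}" "p \<in> A i" for i p
      using e_eq[OF that] that by (simp add: A_def prime_factors_multiplicity)
    show "coprime (geometric_sum p (e p)) q"
      if "i \<in> {1..k}" "j \<in> {1..k}" "p \<in> A i" "q \<in> A j" for i j p q
    proof -
      have "geometric_sum p (e p) dvd S"
        unfolding S_eq[OF that(1)] using that by (intro dvd_prodI) (auto simp: A_def)
      moreover have "q dvd N" using dvd_trans[OF _ dvdN[OF that(2)], of q] that(4) by (auto simp: A_def)
      moreover have "coprime S N"
        using assms(4) by (simp add: coprime_iff_gcd_eq_1 N_def S_def gcd.commute)
      ultimately show ?thesis using coprime_divisors by blast
    qed
  qed (use assms(1) sum in \<open>auto simp: A_def\<close>)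
  have PN: "P = prime_factors N"
  proof -
    have "prime_factors N = (\<Union>i\<in>{1..k}. prime_factors (M i))"
      unfolding N_def using zero by (simp add: prime_factors_prod)
    then show ?thesis unfolding P_def by (simp add: A_def)
  qed
  have NP: "N = (\<Prod>p\<in>P. p ^ e p)"
    unfolding PN e_def by (rule prime_factorization_nat[OF Npos])
  have K: "K = card P" unfolding PN N_def using assms(5) by (simp add: prime_omega_def)
  \<comment> \<open>Without primes \<open>M 1\<close> would be 1 and hence \<open>S = 1\<close>,
    though \<open>S\<close> has at least two positive terms.\<close>
  have "P \<noteq> {}"
  proof
    assume "P = {}"
    then have "N = 1" using NP by simp
    then have "M 1 = 1" using dvdN[of 1] assms(1) by simp
    then have "S = 1" using sigma[of 1] assms(1) by (simp add: divisor_sigma_def)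
    moreover have "(\<Sum>i\<in>{1,2}. M i) \<le> S"
      unfolding S_def using assms(1) by (intro sum_mono2) auto
    ultimately show False using Mpos[of 1] Mpos[of 2] assms(1) by simp
  qed
  then have "K > 0" unfolding K using finite_P by (simp only: card_gt_0_iff simp_thms)
  have "(2::nat) ^ 1 \<le> 2 ^ K" using \<open>K > 0\<close> by (intro power_increasing) auto
  then have "2 * 2 ^ K \<le> (2::nat) ^ K * 2 ^ K" by (intro mult_right_mono) auto
  then have le: "2 * 2 ^ K \<le> (4::nat) ^ K" by (simp flip: power_mult_distrib)
  \<comment> \<open>The exponent is a real difference in the statement and a truncated natural one
    in \<open>prod_powers_le\<close>; by \<open>le\<close> they agree.\<close>
  have "(4 ^ K - 2 * 2 ^ K :: real) = real (4 ^ K - 2 * 2 ^ K)" using le by (simp add: of_nat_diff)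
  then have powr: "2 powr (4 ^ K - 2 * 2 ^ K) = (2::real) ^ (4 ^ K - 2 * 2 ^ K)"
    by (simp only: powr_realpow)
  \<comment> \<open>From sin (pi/6) = 1/2. The factor pi^2/6 only has to exceed 1, which makes the
    inequality strict.\<close>
  have "pi \<ge> 3" using sin_x_le_x[of "pi / 6"] by (simp add: sin_30)
  then have "3 * 3 \<le> pi * pi" by (intro mult_mono) auto
  then have "1 < pi ^ 2 / 6" by (simp add: power2_eq_square)
  then have "1 * (2::real) ^ (4 ^ K - 2 * 2 ^ K) < pi ^ 2 / 6 * 2 ^ (4 ^ K - 2 * 2 ^ K)"
    by (intro mult_strict_right_mono) auto
  moreover have "real N \<le> 2 ^ (4 ^ K - 2 * 2 ^ K)" using prod_powers_le by (simp only: NP[symmetric] K)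
  ultimately show ?thesis unfolding powr N_def by linarith
qed

end
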